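(* Let $\mu$ be a measure on $\mathbb{R}^d$ that is singular with respect to Lebesgue measure, and let $\Lambda\subset\mathbb{R}^d$ be a countable discrete set that is a tight-frame spectrum for $\mu$. Then the spectral gap of $\delta_\Lambda$ is zero; that is, there is no $a>0$ such that $\widehat{\delta_\Lambda}$ vanishes on $B(0,a)\setminus\{0\}$.
   Context: A measure always means a compactly supported Borel probability measure on $\mathbb{R}^d$. A countable set $\Lambda$ is a tight-frame spectrum for $\mu$ if there is a constant $A>0$ with $\sum_{\lambda\in\Lambda}\left|\int f(x)e^{-2\pi i\lambda\cdot x}\,d\mu(x)\right|^2=A\int |f|^2\,d\mu$ for all $f\in L^2(\mu)$. $\delta_\Lambda=\sum_{\lambda\in\Lambda}\delta_\lambda$, which is a tempered distribution, and $\widehat{\delta_\Lambda}$ is its distributional Fourier transform, with convention $\widehat f(\xi)=\int e^{-2\pi i\xi\cdot x}f(x)\,dx$. A distribution vanishes on an open set $V$ if it is zero on every test function with compact support in $V$. A tempered distribution $T$ has a spectral gap $a>0$ if $\widehat T$ vanishes on the punctured open ball $B(0,a)\setminus\{0\}$; if no such $a$ exists, $T$ is said to have zero spectral gap. *)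

theory Defs
  imports "HOL-Analysis.Analysis" "HOL-Probability.Probability_Measure"
begin

definition measure_support :: "'a::topological_space measure \<Rightarrow> 'a set" where
  "measure_support M = {x. \<forall>U. open U \<longrightarrow> x \<in> U \<longrightarrow> emeasure M U > 0}"

definition compact_borel_prob :: "'a::topological_space measure \<Rightarrow> bool" where
  "compact_borel_prob \<mu> \<longleftrightarrow>
     sets \<mu> = sets borel \<and> prob_space \<mu> \<and> compact (measure_support \<mu>)"

definition lebesgue_singular :: "'a::euclidean_space measure \<Rightarrow> bool" where
  "lebesgue_singular \<mu> \<longleftrightarrow>
     (\<exists>N\<in>sets borel. emeasure lborel N = 0 \<and> emeasure \<mu> (UNIV - N) = 0)"

definition fourier_transform :: "'a::euclidean_space measure \<Rightarrow> ('a \<Rightarrow> complex) \<Rightarrow> 'a \<Rightarrow> complex" where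
  "fourier_transform M f \<xi> = (LINT x|M. exp (- 2 * of_real pi * \<i> * of_real (\<xi> \<bullet> x)) * f x)"

definition square_integrable :: "'a measure \<Rightarrow> ('a \<Rightarrow> complex) \<Rightarrow> bool" where
  "square_integrable M f \<longleftrightarrow> f \<in> borel_measurable M \<and> integrable M (\<lambda>x. (cmod (f x))\<^sup>2)"

definition tight_frame_spectrum :: "'a::euclidean_space measure \<Rightarrow> 'a set \<Rightarrow> bool" where
  "tight_frame_spectrum \<mu> \<Lambda> \<longleftrightarrow>
     countable \<Lambda> \<and>
     (\<exists>A>0. \<forall>f. square_integrable \<mu> f \<longrightarrow>
        ((\<lambda>l. (cmod (fourier_transform \<mu> f l))\<^sup>2) has_sum A * (LINT x|\<mu>. (cmod (f x))\<^sup>2)) \<Lambda>)"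

primrec continuously_differentiable ::
    "nat \<Rightarrow> ('a::euclidean_space \<Rightarrow> 'b::real_normed_vector) \<Rightarrow> bool" where
  "continuously_differentiable 0 f \<longleftrightarrow> continuous_on UNIV f"
| "continuously_differentiable (Suc k) f \<longleftrightarrow>
     (\<forall>x. f differentiable (at x)) \<and>
     (\<forall>b\<in>Basis. continuously_differentiable k (\<lambda>x. frechet_derivative f (at x) b))"

definition test_function :: "'a::euclidean_space set \<Rightarrow> ('a \<Rightarrow> complex) \<Rightarrow> bool" where
  "test_function V \<phi> \<longleftrightarrow>
     (\<forall>k. continuously_differentiable k \<phi>) \<and>
     compact (closure {x. \<phi> x \<noteq> 0}) \<and> closure {x. \<phi> x \<noteq> 0} \<subseteq> V"

text \<open>
  A distribution is represented by its action on functions. Only its values on test functions, and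
  for tempered distributions on Schwartz functions, are relevant.
\<close>

type_synonym 'a distribution = "('a \<Rightarrow> complex) \<Rightarrow> complex"

definition distribution_vanishes_on :: "'a::euclidean_space distribution \<Rightarrow> 'a set \<Rightarrow> bool" where
  "distribution_vanishes_on T V \<longleftrightarrow> (\<forall>\<phi>. test_function V \<phi> \<longrightarrow> T \<phi> = 0)"

definition distributional_fourier_transform ::
    "'a::euclidean_space distribution \<Rightarrow> 'a distribution" where
  "distributional_fourier_transform T = (\<lambda>\<phi>. T (fourier_transform lborel \<phi>))"

text \<open>
  If \<open>\<Lambda>\<close> is a tight-frame spectrum of a compactly supported probability measure, then balls of a
  fixed radius contain a bounded number of its points, so the sum converges absolutely on Schwartz
  functions. On non-summable families \<open>infsum\<close> is 0, which could only enlarge the set of test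
  functions annihilated by the transform, so it cannot make a zero spectral gap easier to obtain.
\<close>

definition delta_comb :: "'a::euclidean_space set \<Rightarrow> 'a distribution" where
  "delta_comb \<Lambda> = (\<lambda>\<phi>. infsum \<phi> \<Lambda>)"

definition has_spectral_gap :: "'a::euclidean_space distribution \<Rightarrow> real \<Rightarrow> bool" where
  "has_spectral_gap T a \<longleftrightarrow>
     a > 0 \<and> distribution_vanishes_on (distributional_fourier_transform T) (ball 0 a - {0})"

definition zero_spectral_gap :: "'a::euclidean_space distribution \<Rightarrow> bool" where
  "zero_spectral_gap T \<longleftrightarrow> \<not> (\<exists>a. has_spectral_gap T a)"

end

theory Submission
  imports Defs
begin

text \<open>
  Write \<open>f^\<close> for the Fourier transform of \<open>f\<close>. Suppose that the transform of \<open>\<delta>_\<Lambda>\<close> vanishes on the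
  punctured ball of radius \<open>a\<close>. The contradiction is that \<open>\<Sum>\<lambda>\<in>\<Lambda>. \<phi>^(\<lambda>) = 0\<close> would follow for every
  autocorrelation \<open>\<phi>\<close> of a bounded function \<open>h\<close> supported close to 0: since \<open>\<phi>^ = |h^|^2\<close>, every such
  \<open>h^\<close> would vanish on \<open>\<Lambda>\<close>, but cutting off the character of frequency \<open>\<lambda>0 \<in> \<Lambda>\<close> to a small ball gives
  an \<open>h\<close> for which \<open>h^(\<lambda>0)\<close> is the volume of that ball.

  The gap itself only says that \<open>\<Sum>\<lambda>\<in>\<Lambda>. \<psi>^(\<lambda>) = 0\<close> for smooth \<open>\<psi>\<close> that vanish near 0, so the value at 0
  has to be shown to be invisible to \<open>\<Lambda>\<close>. This is where singularity enters, through a Bessel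
  inequality with respect to Lebesgue measure whose constant is as small as desired
  (\<open>singular_tight_frame_small_bessel\<close>): for every \<open>\<beta> > 0\<close> there is an \<open>r > 0\<close> such that
  \<open>\<Sum>\<lambda>\<in>\<Lambda>. |k^(\<lambda>)|^2 \<le> \<beta> * \<parallel>k\<parallel>^2\<close> for all bounded \<open>k\<close> supported in the ball of radius \<open>r\<close> around 0. Indeed
  a singular \<open>\<mu>\<close> has balls \<open>B(v,r)\<close> whose mass is an arbitrarily large multiple of their volume
  (\<open>singular_dense_ball\<close>), and the average of the translates of \<open>k\<close> over \<open>B(v,r)\<close> with respect to \<open>\<mu>\<close>
  expresses \<open>k^\<close> by transforms of elements of \<open>L^2(\<mu>)\<close>, for which the frame identity holds
  (\<open>tight_frame_bessel_lebesgue\<close>).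

  Now let \<open>R\<close> be a mollifier at scale \<open>\<delta>\<close> and let \<open>g\<close> be the restriction of \<open>\<phi>\<close> to the ball of radius
  \<open>2\<delta>\<close>. The function \<open>(\<phi> - g) * R\<close> is a test function on the punctured ball, so
  \<open>\<Sum> \<phi>^ R^ = \<Sum> g^ R^\<close>. By Cauchy-Schwarz and the Bessel inequality the right-hand side is at most
  \<open>\<beta> * \<parallel>g\<parallel> * \<parallel>R\<parallel>\<close> as soon as \<open>2\<delta> \<le> r\<close>. If \<open>V\<close> is the volume of the ball of radius \<open>2\<delta>\<close>, then \<open>\<parallel>g\<parallel>\<close> is of
  order at most \<open>V^(1/2)\<close> and \<open>\<parallel>R\<parallel>\<close> of order \<open>V^(-1/2)\<close>, so this is \<open>\<beta>\<close> times a constant that does not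
  depend on \<open>\<delta>\<close> (\<open>spectral_gap_mollified_sum_small\<close>). As \<open>\<delta>\<close> tends to 0, the left-hand side tends to
  \<open>\<Sum> \<phi>^\<close>, which therefore is bounded by a constant times \<open>\<beta>\<close> for every \<open>\<beta> > 0\<close>. The cut-off
  at radius \<open>2\<delta>\<close> precedes the mollification, so \<open>R\<close> alone provides the smoothness of the test function.
\<close>

section \<open>Fourier characters\<close>

definition character :: "'a::euclidean_space \<Rightarrow> 'a \<Rightarrow> complex" where
  "character \<xi> x = exp (- 2 * of_real pi * \<i> * of_real (\<xi> \<bullet> x))"

lemma fourier_transform_character: "fourier_transform M f \<xi> = (LINT x|M. character \<xi> x * f x)"
  by (simp add: fourier_transform_def character_def)

lemma norm_character [simp]: "norm (character \<xi> x) = 1"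
  by (simp add: character_def norm_exp_eq_Re)

lemma character_add: "character \<xi> (x + y) = character \<xi> x * character \<xi> y"
  by (simp add: character_def inner_add_right ring_distribs exp_add[symmetric])

lemma character_0 [simp]: "character \<xi> 0 = 1"
  by (simp add: character_def)

lemma cnj_character: "cnj (character \<xi> x) = character \<xi> (- x)"
  by (simp add: character_def exp_cnj)

lemma character_neg_mult [simp]: "character \<xi> x * character \<xi> (- x) = 1"
  by (metis character_0 character_add add.right_inverse)

lemma continuous_character: "continuous_on UNIV (character \<xi>)"
  unfolding character_def by (intro continuous_intros)

lemma borel_measurable_character [measurable]: "character \<xi> \<in> borel_measurable borel"
  using continuous_character by (rule borel_measurable_continuous_onI)

lemma integrable_character_mult:
  assumes "integrable M f" "sets M = sets borel"
  shows "integrable M (\<lambda>x. character \<xi> x * f x)"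
proof (rule Bochner_Integration.integrable_bound[OF assms(1)])
  note [measurable_cong] = assms(2)
  have [measurable]: "f \<in> borel_measurable M" using assms(1) by auto
  show "(\<lambda>x. character \<xi> x * f x) \<in> borel_measurable M" by measurable
qed (simp add: norm_mult)

section \<open>Bessel bounds on small balls\<close>

text \<open>
  Take a compact Lebesgue-null set \<open>K\<close> of positive \<open>\<mu>\<close>-measure and an open \<open>U \<supseteq> K\<close> of tiny volume that
  contains the \<open>r\<close>-neighbourhood of \<open>K\<close>. The product measure of the pairs \<open>(x, y)\<close> with \<open>y \<in> K\<close> and
  \<open>dist x y < r\<close> is \<open>\<mu>(K)\<close> times the volume of an \<open>r\<close>-ball; integrating in the other order bounds it by
  the volume of \<open>U\<close> times the largest \<open>\<mu>\<close>-mass of an \<open>r\<close>-ball. The comparison is with the ball of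
  doubled radius because that ball occurs in \<open>tight_frame_bessel_lebesgue\<close>.
\<close>

lemma singular_dense_ball:
  fixes \<mu> :: "'a::euclidean_space measure"
  assumes sets: "sets \<mu> = sets borel" and "prob_space \<mu>" and sing: "lebesgue_singular \<mu>"
  obtains v r where "0 < r" "measure \<mu> (ball v r) > M * measure lborel (ball (0::'a) (2*r))"
proof -
  interpret prob_space \<mu> by fact
  interpret P: pair_sigma_finite lborel \<mu> ..
  have sp: "space \<mu> = UNIV" using sets_eq_imp_space_eq[OF sets] by simp
  note [measurable_cong] = sets
  define M' where "M' = max M 1"
  have M': "M' > 0" "M \<le> M'" by (auto simp: M'_def)
  obtain N where N: "N \<in> sets borel" "emeasure lborel N = 0" "emeasure \<mu> (UNIV - N) = 0"
    using sing by (auto simp: lebesgue_singular_def)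
  have "emeasure \<mu> N = 1"
  proof -
    have "emeasure \<mu> N + emeasure \<mu> (UNIV - N) = emeasure \<mu> UNIV"
      using N(1) by (subst plus_emeasure) (auto simp: sets)
    thus ?thesis using N(3) emeasure_space_1 sp by simp
  qed
  then have "(SUP K \<in> {K. K \<subseteq> N \<and> compact K}. emeasure \<mu> K) > 0"
    using inner_regular[OF sets _ N(1)] by simp
  then obtain K where K: "K \<subseteq> N" "compact K" "emeasure \<mu> K > 0"
    by (auto simp: less_SUP_iff)
  have Kb[measurable]: "K \<in> sets borel" using K(2) by (simp add: borel_compact)
  have mK: "measure \<mu> K > 0" using K(3) by (simp add: emeasure_eq_measure)
  have K0: "emeasure lborel K = 0"
    using K(1) N(1,2) by (metis emeasure_mono le_zero_eq sets_lborel)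
  \<comment> \<open>Half of the least volume of \<open>U\<close> compatible with every \<open>r\<close>-ball having \<open>\<mu>\<close>-mass at most \<open>M'\<close> times the
  volume of the ball of doubled radius.\<close>
  define \<eta> where "\<eta> = measure \<mu> K / (M' * 2 ^ DIM('a)) / 2"
  have \<eta>: "\<eta> > 0" using mK M' by (simp add: \<eta>_def)
  obtain U where U: "K \<subseteq> U" "open U" "emeasure lborel (U - K) < ennreal \<eta>"
    using outer_regular_lborel[OF Kb \<eta>] by blast
  have [measurable]: "U \<in> sets borel" using U by simp
  have Ule: "emeasure lborel U \<le> ennreal \<eta>"
  proof -
    have "emeasure lborel U \<le> emeasure lborel K + emeasure lborel (U - K)"
      using U(1) by (subst plus_emeasure) (auto simp: Un_absorb1)
    thus ?thesis using K0 U(3) by simp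
  qed
  obtain r where r: "r > 0" "(\<Union>x\<in>K. ball x r) \<subseteq> U"
    using compact_subset_open_imp_ball_epsilon_subset[OF K(2) U(2,1)] by blast
  define B where "B = measure lborel (ball (0::'a) r)"
  have B: "B > 0" unfolding B_def using r by (simp add: content_ball_pos)
  have fin: "emeasure lborel (ball x r) = ennreal B" for x :: 'a
    using emeasure_lborel_ball_finite[of x r] content_ball_conv_unit_ball[of r x] content_ball_conv_unit_ball[of r "0::'a"] r(1)
    by (subst emeasure_eq_ennreal_measure) (auto simp: B_def)
  have B2: "measure lborel (ball (0::'a) (2*r)) = 2 ^ DIM('a) * B"
    using content_ball_conv_unit_ball[of r "0::'a"] content_ball_conv_unit_ball[of "2*r" "0::'a"] r(1)
    by (simp add: B_def power_mult_distrib)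
  have "\<exists>v. measure \<mu> (ball v r) > M' * measure lborel (ball (0::'a) (2*r))"
  proof (rule ccontr)
    define c where "c = M' * measure lborel (ball (0::'a) (2*r))"
    assume "\<nexists>v. measure \<mu> (ball v r) > M' * measure lborel (ball (0::'a) (2*r))"
    hence le: "measure \<mu> (ball v r) \<le> c" for v by (force simp: not_less c_def)
    have "ennreal (B * measure \<mu> K) = (\<integral>\<^sup>+y. ennreal B * indicator K y \<partial>\<mu>)"
      using B by (subst nn_integral_cmult_indicator) (auto simp: emeasure_eq_measure ennreal_mult sets)
    also have "\<dots> = (\<integral>\<^sup>+y. \<integral>\<^sup>+x. indicator K y * indicator {p. dist (fst p) (snd p) < r} (x, y) \<partial>lborel \<partial>\<mu>)"
    proof (rule nn_integral_cong)
      fix y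
      have "(\<integral>\<^sup>+x. indicator K y * indicator {p. dist (fst p) (snd p) < r} (x, y) \<partial>lborel)
          = (\<integral>\<^sup>+x. indicator K y * indicator (ball y r) x \<partial>lborel)"
        by (intro nn_integral_cong) (auto simp: indicator_def dist_commute)
      also have "\<dots> = indicator K y * emeasure lborel (ball y r)"
        by (subst nn_integral_cmult_indicator) auto
      finally show "ennreal B * indicator K y = (\<integral>\<^sup>+x. indicator K y * indicator {p. dist (fst p) (snd p) < r} (x, y) \<partial>lborel)"
        by (simp add: fin mult.commute)
    qed
    also have "\<dots> = (\<integral>\<^sup>+x. \<integral>\<^sup>+y. indicator K y * indicator {p. dist (fst p) (snd p) < r} (x, y) \<partial>\<mu> \<partial>lborel)"
      by (rule P.Fubini') measurable
    also have "\<dots> \<le> (\<integral>\<^sup>+x. ennreal c * indicator U x \<partial>lborel)"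
    proof (rule nn_integral_mono)
      fix x
      have near: "x \<in> U" if "y \<in> K" "dist x y < r" for y
      proof -
        have "x \<in> ball y r" using that by (simp add: dist_commute)
        thus ?thesis using r(2) that(1) by blast
      qed
      have "(\<integral>\<^sup>+y. indicator K y * indicator {p. dist (fst p) (snd p) < r} (x, y) \<partial>\<mu>)
          \<le> (\<integral>\<^sup>+y. indicator U x * indicator (ball x r) y \<partial>\<mu>)"
        using near by (intro nn_integral_mono) (auto simp: indicator_def)
      also have "\<dots> = indicator U x * emeasure \<mu> (ball x r)"
        by (subst nn_integral_cmult_indicator) (auto simp: sets)
      also have "\<dots> \<le> indicator U x * ennreal c"
        using le[of x] by (intro mult_left_mono) (auto simp: emeasure_eq_measure intro: ennreal_leI)
      finally show "(\<integral>\<^sup>+y. indicator K y * indicator {p. dist (fst p) (snd p) < r} (x, y) \<partial>\<mu>)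
          \<le> ennreal c * indicator U x" by (simp add: mult.commute)
    qed
    also have "\<dots> = ennreal c * emeasure lborel U"
      by (subst nn_integral_cmult_indicator) auto
    also have "\<dots> \<le> ennreal c * ennreal \<eta>" using Ule by (intro mult_left_mono) auto
    also have "\<dots> = ennreal (c * \<eta>)" using \<eta> M' B by (simp add: ennreal_mult c_def)
    finally have "B * measure \<mu> K \<le> c * \<eta>"
      using \<eta> M' B by (subst (asm) ennreal_le_iff) (auto simp: c_def)
    also have "c * \<eta> = B * measure \<mu> K / 2" using M' by (simp add: c_def \<eta>_def B2)
    finally show False using B mK by simp
  qed
  then obtain v where v: "measure \<mu> (ball v r) > M' * measure lborel (ball (0::'a) (2*r))" by blast
  have "M * measure lborel (ball (0::'a) (2*r)) \<le> M' * measure lborel (ball (0::'a) (2*r))"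
    using M' by (intro mult_right_mono) auto
  with v show ?thesis using that[of r v] r(1) by linarith
qed

text \<open>
  Cauchy-Schwarz against the indicator of \<open>B\<close>, from the discriminant of the nonnegative quadratic
  \<open>t \<mapsto> \<integral>(t 1_B - f)^2\<close>.
\<close>

lemma integral_square_le:
  fixes f :: "'a \<Rightarrow> real"
  assumes f: "integrable M f" and f2: "integrable M (\<lambda>x. (f x)\<^sup>2)"
    and B: "B \<in> sets M" "emeasure M B < \<infinity>" and supp: "\<And>x. x \<notin> B \<Longrightarrow> f x = 0"
  shows "(LINT x|M. f x)\<^sup>2 \<le> measure M B * (LINT x|M. (f x)\<^sup>2)"
proof -
  define b I J where "b = measure M B" and "I = (LINT x|M. f x)" and "J = (LINT x|M. (f x)\<^sup>2)"
  have quad: "0 \<le> t\<^sup>2 * b - 2 * t * I + J" for t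
  proof -
    have i: "integrable M (indicator B :: 'a \<Rightarrow> real)" using B by (simp add: less_top)
    have eq: "(t * indicator B x - f x)\<^sup>2 = t\<^sup>2 * indicator B x - 2 * t * f x + (f x)\<^sup>2" for x
      using supp[of x] by (cases "x \<in> B") (auto simp: power2_eq_square algebra_simps)
    have "0 \<le> (LINT x|M. (t * indicator B x - f x)\<^sup>2)" by (rule Bochner_Integration.integral_nonneg) simp
    also have "\<dots> = t\<^sup>2 * b - 2 * t * I + J"
      unfolding eq using i f f2 B by (simp add: b_def I_def J_def)
    finally show ?thesis .
  qed
  show ?thesis
  proof (cases "b = 0")
    case True
    hence "0 \<le> - 2 * t * I + J" for t using quad[of t] by simp
    from this[of "(J + 1) / (2 * I)"] have "I = 0" by (cases "I = 0") (auto simp: field_simps)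
    thus ?thesis by (simp add: I_def[symmetric] b_def[symmetric] True)
  next
    case False
    hence b: "b > 0" using measure_nonneg[of M B] unfolding b_def by linarith
    have "0 \<le> (I/b)\<^sup>2 * b - 2 * (I/b) * I + J" by (rule quad)
    also have "\<dots> = J - I\<^sup>2 / b" using b by (simp add: power2_eq_square field_simps)
    finally have "I\<^sup>2 \<le> b * J" using b by (simp add: field_simps)
    thus ?thesis by (simp add: I_def b_def J_def)
  qed
qed

lemma lborel_integral_translate:
  fixes f :: "'a::euclidean_space \<Rightarrow> 'b::{banach, second_countable_topology}"
  assumes [measurable]: "f \<in> borel_measurable borel"
  shows "(LINT x|lborel. f (c + x)) = (LINT x|lborel. f x)"
proof -
  have "(LINT x|lborel. f x) = (LINT x|distr lborel borel ((+) c). f x)"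
    by (simp add: lborel_distr_plus)
  also have "\<dots> = (LINT x|lborel. f (c + x))"
    by (rule integral_distr) auto
  finally show ?thesis ..
qed

text \<open>
  Let \<open>E\<close> be the ball of radius \<open>r\<close> around \<open>v\<close>. For every \<open>y \<in> E\<close> the substitution \<open>x = y + u - v\<close> writes
  \<open>k^(l)\<close>, up to the unimodular factor \<open>character l v\<close>, as an integral over \<open>u\<close>, and only \<open>u\<close> with \<open>norm u < 2 * r\<close> contribute.
  Averaging over \<open>y \<in> E\<close> with respect to \<open>\<mu>\<close> and exchanging the integrals turns \<open>\<mu>(E) k^(l)\<close> into the
  integral over \<open>u\<close> of the \<open>\<mu>\<close>-transforms of \<open>G u = (\<lambda>y. 1_E(y) k(y + u - v))\<close>. Cauchy-Schwarz in \<open>u\<close> and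
  the frame identity for each \<open>G u\<close> finish the proof.
\<close>

lemma tight_frame_bessel_lebesgue:
  fixes \<mu> :: "'a::euclidean_space measure" and k :: "'a \<Rightarrow> complex"
  assumes sets: "sets \<mu> = sets borel" and "prob_space \<mu>"
    and frame: "\<And>f. square_integrable \<mu> f \<Longrightarrow>
        ((\<lambda>l. (cmod (fourier_transform \<mu> f l))\<^sup>2) has_sum A * (LINT x|\<mu>. (cmod (f x))\<^sup>2)) \<Lambda>"
    and k[measurable]: "k \<in> borel_measurable borel" and kC: "\<And>x. norm (k x) \<le> C"
    and supp: "\<And>x. x \<notin> ball 0 r \<Longrightarrow> k x = 0"
    and F: "finite F" "F \<subseteq> \<Lambda>"
  shows "(measure \<mu> (ball v r))\<^sup>2 * (\<Sum>l\<in>F. (cmod (fourier_transform lborel k l))\<^sup>2)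
     \<le> measure lborel (ball (0::'a) (2*r)) * (A * (measure \<mu> (ball v r) * (LINT x|lborel. (cmod (k x))\<^sup>2)))"
proof -
  interpret prob_space \<mu> by fact
  interpret P: pair_sigma_finite lborel \<mu> ..
  note [measurable_cong] = sets
  define m where "m = measure \<mu> (ball v r)"
  define E where "E = ball v r"
  define B where "B = ball (0::'a) (2*r)"
  have [measurable]: "E \<in> sets borel" "B \<in> sets borel" by (auto simp: E_def B_def)
  have C0: "C \<ge> 0" using kC[of 0] norm_ge_zero order_trans by blast
  define G where "G u y = indicator E y * k (y + u - v)" for u y
  have [measurable]: "(\<lambda>(u, y). G u y) \<in> borel_measurable (lborel \<Otimes>\<^sub>M \<mu>)"
    "(\<lambda>p. G (fst p) (snd p)) \<in> borel_measurable (lborel \<Otimes>\<^sub>M \<mu>)"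
    unfolding G_def by (simp_all add: case_prod_beta)
  have Gb: "norm (G u y) \<le> C" for u y
    using kC[of "y + u - v"] C0 by (auto simp: G_def indicator_def norm_mult)
  have G0: "G u y = 0" if "u \<notin> B" for u y
  proof (cases "y \<in> E")
    case True
    have "y + u - v \<notin> ball 0 r"
    proof
      assume "y + u - v \<in> ball 0 r"
      hence "norm (y + u - v) < r" by simp
      moreover have "norm (v - y) < r" using True by (simp add: E_def dist_norm)
      ultimately have "norm ((y + u - v) + (v - y)) < r + r" using norm_add_less by blast
      thus False using that by (simp add: B_def)
    qed
    thus ?thesis using supp by (simp add: G_def)
  qed (simp add: G_def)
  have finB: "emeasure lborel B < \<infinity>" unfolding B_def by (rule emeasure_lborel_ball_finite)
  have int: "integrable (lborel \<Otimes>\<^sub>M \<mu>) (\<lambda>(u, y). f u y)"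
    if "(\<lambda>(u, y). f u y) \<in> borel_measurable (lborel \<Otimes>\<^sub>M \<mu>)" "\<And>u y. norm (f u y) \<le> D" "\<And>u y. u \<notin> B \<Longrightarrow> f u y = 0"
    for f :: "'a \<Rightarrow> 'a \<Rightarrow> 'c::{banach, second_countable_topology}" and D
  proof (rule integrableI_bounded_set[where A="B \<times> UNIV" and B=D])
    show "emeasure (lborel \<Otimes>\<^sub>M \<mu>) (B \<times> UNIV) < \<infinity>"
      using finB by (subst emeasure_pair_measure_Times) (auto simp: sets emeasure_eq_measure ennreal_mult_less_top)
  qed (use that in \<open>auto simp: sets intro!: AE_I2\<close>)
  define H where "H l u = fourier_transform \<mu> (G u) l" for l u
  have Hdef: "H l u = (LINT y|\<mu>. character l y * G u y)" for l u
    by (simp add: H_def fourier_transform_character)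
  have Hm[measurable]: "H l \<in> borel_measurable lborel" for l
    unfolding Hdef[abs_def] by (rule borel_measurable_lebesgue_integral) (simp add: case_prod_beta)
  have H0: "H l u = 0" if "u \<notin> B" for l u using G0[OF that] by (simp add: Hdef)
  have Hb: "norm (H l u) \<le> C" for l u
  proof -
    have "norm (H l u) \<le> (LINT y|\<mu>. norm (character l y * G u y))"
      unfolding Hdef by (rule integral_norm_bound)
    also have "\<dots> \<le> (LINT y|\<mu>. C)"
      using Gb by (intro integral_mono integrable_norm integrable_const integrable_const_bound[where B=C])
        (auto simp: norm_mult G_def)
    finally show ?thesis by (simp add: prob_space)
  qed
  have intB: "integrable lborel f" if "f \<in> borel_measurable lborel" "\<And>u. norm (f u) \<le> D" "\<And>u. u \<notin> B \<Longrightarrow> f u = 0"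
    for f :: "'a \<Rightarrow> 'c::{banach, second_countable_topology}" and D
    by (rule integrableI_bounded_set[where A=B and B=D]) (use that finB in auto)
  \<comment> \<open>Both sides are the double integral of \<open>character l (y + u) * G u y\<close>, evaluated in the two orders.\<close>
  have main: "character l v * (of_real m * fourier_transform lborel k l) = (LINT u|lborel. character l u * H l u)" for l
  proof -
    have i: "integrable (lborel \<Otimes>\<^sub>M \<mu>) (\<lambda>(u, y). character l u * (character l y * G u y))"
      by (rule int[of _ C]) (auto simp: case_prod_beta norm_mult Gb G0)
    have "(LINT u|lborel. character l u * H l u) = (LINT u|lborel. LINT y|\<mu>. character l u * (character l y * G u y))"
      unfolding Hdef by (subst integral_mult_right_zero) simp
    also have "\<dots> = (LINT y|\<mu>. LINT u|lborel. character l u * (character l y * G u y))"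
      by (rule P.Fubini_integral[OF i, symmetric])
    also have "\<dots> = (LINT y|\<mu>. (character l v * fourier_transform lborel k l) * of_real (indicator E y))"
    proof (rule Bochner_Integration.integral_cong[OF refl])
      fix y
      have "(LINT u|lborel. character l u * (character l y * G u y))
         = (LINT u|lborel. (character l v * of_real (indicator E y)) * (character l ((y - v) + u) * k ((y - v) + u)))"
      proof (rule Bochner_Integration.integral_cong[OF refl])
        fix u
        have "character l v * character l ((y - v) + u) = character l (v + ((y - v) + u))" by (rule character_add[symmetric])
        also have "v + ((y - v) + u) = u + y" by simp
        also have "character l (u + y) = character l u * character l y" by (rule character_add)
        finally show "character l u * (character l y * G u y) =
           (character l v * of_real (indicator E y)) * (character l ((y - v) + u) * k ((y - v) + u))"
          unfolding G_def by (cases "y \<in> E") (simp_all add: mult_ac algebra_simps)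
      qed
      also have "\<dots> = (character l v * of_real (indicator E y)) * fourier_transform lborel k l"
        unfolding fourier_transform_character
        by (subst integral_mult_right_zero, subst lborel_integral_translate[of "\<lambda>x. character l x * k x"]) auto
      finally show "(LINT u|lborel. character l u * (character l y * G u y)) =
         (character l v * fourier_transform lborel k l) * of_real (indicator E y)"
        by (simp add: mult_ac)
    qed
    also have "\<dots> = character l v * fourier_transform lborel k l * of_real m"
      by (subst integral_mult_right_zero, subst integral_of_real)
         (auto simp: m_def E_def sets emeasure_eq_measure intro!: integrable_real_indicator)
    finally show ?thesis by (simp add: mult_ac)
  qed
  have step: "m\<^sup>2 * (cmod (fourier_transform lborel k l))\<^sup>2 \<le> measure lborel B * (LINT u|lborel. (cmod (H l u))\<^sup>2)" for l
  proof -
    have m0: "m \<ge> 0" by (simp add: m_def)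
    have "m * cmod (fourier_transform lborel k l) = cmod (LINT u|lborel. character l u * H l u)"
      unfolding main[symmetric] using m0 by (simp add: norm_mult)
    also have "\<dots> \<le> (LINT u|lborel. cmod (character l u * H l u))" by (rule integral_norm_bound)
    finally have "m * cmod (fourier_transform lborel k l) \<le> (LINT u|lborel. cmod (H l u))" by (simp add: norm_mult)
    hence "(m * cmod (fourier_transform lborel k l))\<^sup>2 \<le> (LINT u|lborel. cmod (H l u))\<^sup>2"
      using m0 by (intro power_mono) auto
    also have "\<dots> \<le> measure lborel B * (LINT u|lborel. (cmod (H l u))\<^sup>2)"
      using Hb H0 C0 by (intro integral_square_le intB[of _ C] intB[of _ "C\<^sup>2"] finB) (auto intro: power_mono)
    finally show ?thesis by (simp add: power_mult_distrib)
  qed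
  have iH: "integrable lborel (\<lambda>u. (cmod (H l u))\<^sup>2)" for l
    using Hb H0 by (intro intB[of _ "C\<^sup>2"]) (auto intro: power_mono)
  have iG: "integrable (lborel \<Otimes>\<^sub>M \<mu>) (\<lambda>(u, y). (cmod (G u y))\<^sup>2)"
    using Gb G0 by (intro int[of _ "C\<^sup>2"]) (auto simp: case_prod_beta intro: power_mono)
  have "m\<^sup>2 * (\<Sum>l\<in>F. (cmod (fourier_transform lborel k l))\<^sup>2) \<le> (\<Sum>l\<in>F. measure lborel B * (LINT u|lborel. (cmod (H l u))\<^sup>2))"
    unfolding sum_distrib_left by (rule sum_mono) (rule step)
  also have "\<dots> = measure lborel B * (LINT u|lborel. (\<Sum>l\<in>F. (cmod (H l u))\<^sup>2))"
    using iH by (simp add: sum_distrib_left)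
  also have "(LINT u|lborel. (\<Sum>l\<in>F. (cmod (H l u))\<^sup>2)) \<le> (LINT u|lborel. A * (LINT y|\<mu>. (cmod (G u y))\<^sup>2))"
  proof (rule integral_mono)
    show "integrable lborel (\<lambda>u. \<Sum>l\<in>F. (cmod (H l u))\<^sup>2)" using iH by simp
    show "integrable lborel (\<lambda>u. A * (LINT y|\<mu>. (cmod (G u y))\<^sup>2))"
      using P.integrable_fst[OF iG] by simp
    fix u
    have "square_integrable \<mu> (G u)" unfolding square_integrable_def
    proof
      show [measurable]: "G u \<in> borel_measurable \<mu>" unfolding G_def by measurable
      show "integrable \<mu> (\<lambda>x. (cmod (G u x))\<^sup>2)"
        using Gb by (intro integrable_const_bound[where B="C\<^sup>2"]) (auto intro!: AE_I2 power_mono)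
    qed
    from frame[OF this] have hs: "((\<lambda>l. (cmod (H l u))\<^sup>2) has_sum A * (LINT y|\<mu>. (cmod (G u y))\<^sup>2)) \<Lambda>"
      by (simp add: H_def)
    show "(\<Sum>l\<in>F. (cmod (H l u))\<^sup>2) \<le> A * (LINT y|\<mu>. (cmod (G u y))\<^sup>2)"
      by (rule has_sum_mono2[OF has_sum_finite hs]) (use F in auto)
  qed
  also have "\<dots> = A * (LINT y|\<mu>. LINT u|lborel. (cmod (G u y))\<^sup>2)"
    using P.Fubini_integral[OF iG] by simp
  also have "(LINT y|\<mu>. LINT u|lborel. (cmod (G u y))\<^sup>2) = (LINT y|\<mu>. (LINT x|lborel. (cmod (k x))\<^sup>2) * indicator E y)"
  proof (rule Bochner_Integration.integral_cong[OF refl])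
    fix y
    have "(LINT u|lborel. (cmod (G u y))\<^sup>2) = (LINT u|lborel. indicator E y * (cmod (k ((y - v) + u)))\<^sup>2)"
      unfolding G_def by (rule Bochner_Integration.integral_cong) (auto simp: indicator_def algebra_simps)
    also have "\<dots> = indicator E y * (LINT x|lborel. (cmod (k x))\<^sup>2)"
      by (subst integral_mult_right_zero, subst lborel_integral_translate[of "\<lambda>x. (cmod (k x))\<^sup>2"]) auto
    finally show "(LINT u|lborel. (cmod (G u y))\<^sup>2) = (LINT x|lborel. (cmod (k x))\<^sup>2) * indicator E y"
      by (simp add: mult_ac)
  qed
  also have "\<dots> = m * (LINT x|lborel. (cmod (k x))\<^sup>2)"
    by (subst integral_mult_right_zero) (auto simp: m_def E_def sets mult_ac)
  finally show ?thesis
    by (simp add: m_def B_def mult_left_mono)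
qed

text \<open>
  Bounded functions and finite partial sums suffice for all applications, and for them every integral
  and sum involved converges.
\<close>

definition bessel_on_ball :: "'a::euclidean_space set \<Rightarrow> real \<Rightarrow> real \<Rightarrow> bool" where
  "bessel_on_ball \<Lambda> r \<beta> \<longleftrightarrow>
     (\<forall>k C F. k \<in> borel_measurable borel \<longrightarrow> (\<forall>x. cmod (k x) \<le> C) \<longrightarrow> (\<forall>x. x \<notin> ball 0 r \<longrightarrow> k x = 0) \<longrightarrow>
        finite F \<longrightarrow> F \<subseteq> \<Lambda> \<longrightarrow>
        (\<Sum>l\<in>F. (cmod (fourier_transform lborel k l))\<^sup>2) \<le> \<beta> * (LINT x|lborel. (cmod (k x))\<^sup>2))"

lemma bessel_on_ballD:
  assumes "bessel_on_ball \<Lambda> r \<beta>" "k \<in> borel_measurable borel" "\<And>x. cmod (k x) \<le> C"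
    "\<And>x. x \<notin> ball 0 r \<Longrightarrow> k x = 0" "finite F" "F \<subseteq> \<Lambda>"
  shows "(\<Sum>l\<in>F. (cmod (fourier_transform lborel k l))\<^sup>2) \<le> \<beta> * (LINT x|lborel. (cmod (k x))\<^sup>2)"
  using assms unfolding bessel_on_ball_def by blast

text \<open>
  The constant given by \<open>tight_frame_bessel_lebesgue\<close> is \<open>A\<close> times the ratio between the volume of a ball
  of radius \<open>2 * r\<close> and the \<open>\<mu>\<close>-mass of a ball of radius \<open>r\<close>; singularity makes this ratio small.
\<close>

lemma singular_tight_frame_small_bessel:
  fixes \<mu> :: "'a::euclidean_space measure"
  assumes sets: "sets \<mu> = sets borel" and "prob_space \<mu>" and sing: "lebesgue_singular \<mu>"
    and A: "A > 0" and frame: "\<And>f. square_integrable \<mu> f \<Longrightarrow>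
        ((\<lambda>l. (cmod (fourier_transform \<mu> f l))\<^sup>2) has_sum A * (LINT x|\<mu>. (cmod (f x))\<^sup>2)) \<Lambda>"
    and \<beta>: "\<beta> > 0"
  shows "\<exists>r>0. bessel_on_ball \<Lambda> r \<beta>"
proof -
  obtain v r where r: "0 < r" and dense: "measure \<mu> (ball v r) > A / \<beta> * measure lborel (ball (0::'a) (2*r))"
    by (rule singular_dense_ball[OF sets assms(2) sing])
  define m V where "m = measure \<mu> (ball v r)" and "V = measure lborel (ball (0::'a) (2*r))"
  have V: "V > 0" using r by (simp add: V_def content_ball_pos)
  have AV: "A * V < \<beta> * m" using dense \<beta> by (simp add: m_def V_def field_simps)
  hence m: "m > 0" using A V \<beta> by (smt (verit) mult_pos_pos zero_less_mult_pos)
  have "bessel_on_ball \<Lambda> r \<beta>"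
    unfolding bessel_on_ball_def
  proof (intro allI impI)
    fix k :: "'a \<Rightarrow> complex" and C and F
    assume k: "k \<in> borel_measurable borel" "\<forall>x. cmod (k x) \<le> C" "\<forall>x. x \<notin> ball 0 r \<longrightarrow> k x = 0"
       and F: "finite F" "F \<subseteq> \<Lambda>"
    note b = tight_frame_bessel_lebesgue[where v=v, OF sets assms(2) frame k(1) k(2)[rule_format] k(3)[rule_format] F]
    define S J where "S = (\<Sum>l\<in>F. (cmod (fourier_transform lborel k l))\<^sup>2)" and "J = (LINT x|lborel. (cmod (k x))\<^sup>2)"
    have J: "J \<ge> 0" by (simp add: J_def)
    have "m\<^sup>2 * S \<le> V * (A * (m * J))" using b by (simp add: m_def V_def S_def J_def)
    hence "m * (m * S) \<le> m * (A * V * J)" by (simp add: power2_eq_square mult_ac)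
    hence "m * S \<le> A * V * J" using m by simp
    also have "\<dots> \<le> \<beta> * m * J" using AV J by (intro mult_right_mono) auto
    finally have "m * S \<le> m * (\<beta> * J)" by (simp add: mult_ac)
    hence "S \<le> \<beta> * J" using m by simp
    thus "(\<Sum>l\<in>F. (cmod (fourier_transform lborel k l))\<^sup>2) \<le> \<beta> * (LINT x|lborel. (cmod (k x))\<^sup>2)"
      by (simp add: S_def J_def)
  qed
  with r show ?thesis by blast
qed

section \<open>Smooth functions and mollifiers\<close>

text \<open>
  The derivative demanded by \<open>continuously_differentiable\<close> is a choice function; this rule lets one
  exhibit an explicit derivative instead.
\<close>

lemma continuously_differentiable_SucI:
  assumes "\<And>x. (f has_derivative f' x) (at x)"
    and "\<And>b. b \<in> Basis \<Longrightarrow> continuously_differentiable k (\<lambda>x. f' x b)"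
  shows "continuously_differentiable (Suc k) f"
proof -
  have "frechet_derivative f (at x) = f' x" for x
    using frechet_derivative_at[OF assms(1)] by simp
  moreover have "f differentiable (at x)" for x using assms(1) by (rule differentiableI)
  ultimately show ?thesis using assms(2) by simp
qed

lemma continuously_differentiable_SucD:
  assumes "continuously_differentiable (Suc k) f"
  shows "(f has_derivative frechet_derivative f (at x)) (at x)"
    and "b \<in> Basis \<Longrightarrow> continuously_differentiable k (\<lambda>x. frechet_derivative f (at x) b)"
proof -
  have "f differentiable (at x)" using assms by simp
  thus "(f has_derivative frechet_derivative f (at x)) (at x)" by (simp only: frechet_derivative_works)
qed (use assms in simp)

lemma continuously_differentiable_Suc_imp:
  "continuously_differentiable (Suc k) f \<Longrightarrow> continuously_differentiable k f"
proof (induction k arbitrary: f)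
  case 0
  then show ?case
    by (auto simp: continuous_on_eq_continuous_at differentiable_imp_continuous_within)
next
  case (Suc k)
  have "continuously_differentiable k (\<lambda>x. frechet_derivative f (at x) b)" if "b \<in> Basis" for b
    by (rule Suc.IH[OF continuously_differentiable_SucD(2)[OF Suc.prems that]])
  moreover have "f differentiable (at x)" for x using Suc.prems by simp
  ultimately show ?case by simp
qed

lemma continuously_differentiable_const: "continuously_differentiable k (\<lambda>_. c)"
proof (induction k arbitrary: c)
  case (Suc k)
  show ?case by (rule continuously_differentiable_SucI[where f'="\<lambda>_ _. 0"]) (use Suc in auto)
qed simp

lemma continuously_differentiable_add:
  "continuously_differentiable k f \<Longrightarrow> continuously_differentiable k g \<Longrightarrow>
    continuously_differentiable k (\<lambda>x. f x + g x)"
proof (induction k arbitrary: f g)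
  case 0
  then show ?case by (auto intro: continuous_on_add)
next
  case (Suc k)
  note d = continuously_differentiable_SucD[OF Suc.prems(1)] continuously_differentiable_SucD[OF Suc.prems(2)]
  show ?case
    by (rule continuously_differentiable_SucI[OF has_derivative_add[OF d(1,3)]]) (intro Suc.IH d(2,4))
qed

lemma continuously_differentiable_mult:
  fixes f g :: "'a::euclidean_space \<Rightarrow> 'b::real_normed_algebra"
  shows "continuously_differentiable k f \<Longrightarrow> continuously_differentiable k g \<Longrightarrow>
    continuously_differentiable k (\<lambda>x. f x * g x)"
proof (induction k arbitrary: f g)
  case 0
  then show ?case by (auto intro: continuous_on_mult)
next
  case (Suc k)
  note d = continuously_differentiable_SucD[OF Suc.prems(1)] continuously_differentiable_SucD[OF Suc.prems(2)]
  show ?case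
    by (rule continuously_differentiable_SucI[OF has_derivative_mult[OF d(1,3)]])
      (intro continuously_differentiable_add Suc.IH d(2,4) Suc.prems[THEN continuously_differentiable_Suc_imp])
qed

lemma continuously_differentiable_inner_const:
  "continuously_differentiable k (\<lambda>x::'a::euclidean_space. x \<bullet> b)"
proof (cases k)
  case (Suc n)
  show ?thesis unfolding Suc
    by (rule continuously_differentiable_SucI[where f'="\<lambda>_ h. h \<bullet> b"])
      (rule bounded_linear_imp_has_derivative[OF bounded_linear_inner_left] continuously_differentiable_const)+
qed (simp add: continuous_intros)

lemma continuously_differentiable_of_real:
  fixes f :: "'a::euclidean_space \<Rightarrow> real"
  shows "continuously_differentiable k f \<Longrightarrow> continuously_differentiable k (\<lambda>x. complex_of_real (f x))"
proof (induction k arbitrary: f)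
  case 0
  then show ?case by (auto intro: continuous_on_of_real)
next
  case (Suc k)
  note d = continuously_differentiable_SucD[OF Suc.prems(1)]
  show ?case
    by (rule continuously_differentiable_SucI[OF has_derivative_of_real[OF d(1)]]) (intro Suc.IH d(2))
qed

text \<open>
  The derivatives of \<open>t \<mapsto> exp (- 1/t)\<close>, extended by 0 to \<open>t \<le> 0\<close>, are linear combinations of these functions.
  Smoothness of the bump function below is an induction over the whole family at once.
\<close>

definition flat_exp :: "nat \<Rightarrow> real \<Rightarrow> real" where
  "flat_exp j t = (if t > 0 then (1 / t) ^ j * exp (- (1 / t)) else 0)"

lemma flat_exp_tendsto_0: "(flat_exp j \<longlongrightarrow> 0) (at 0)"
proof -
  have "((\<lambda>t. (inverse t) ^ j / exp (inverse t)) \<longlongrightarrow> (0::real)) (at_right 0)"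
    by (rule filterlim_compose[OF tendsto_power_div_exp_0 filterlim_inverse_at_top_right])
  moreover have "\<forall>\<^sub>F t in at_right 0. (inverse t) ^ j / exp (inverse t) = flat_exp j t"
    unfolding eventually_at_right_field by (intro exI[of _ 1]) (auto simp: flat_exp_def exp_minus field_simps)
  ultimately have r: "(flat_exp j \<longlongrightarrow> 0) (at_right 0)"
    by (rule Lim_transform_eventually)
  have "\<forall>\<^sub>F t in at_left 0. 0 = flat_exp j t"
    unfolding eventually_at_left_field by (intro exI[of _ "-1"]) (auto simp: flat_exp_def)
  hence l: "(flat_exp j \<longlongrightarrow> 0) (at_left 0)"
    by (rule Lim_transform_eventually[OF tendsto_const])
  show ?thesis using l r by (rule filterlim_split_at)
qed

lemma DERIV_flat_exp:
  "(flat_exp j has_real_derivative (- real j * flat_exp (Suc j) t + flat_exp (Suc (Suc j)) t)) (at t)"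
proof -
  consider "t < 0" | "t = 0" | "t > 0" by linarith
  thus ?thesis
  proof cases
    case 1
    have "((\<lambda>_. 0) has_real_derivative 0) (at t)" by simp
    hence "(flat_exp j has_real_derivative 0) (at t)"
      by (rule has_field_derivative_transform_within_open[where S="{..<0}"]) (use 1 in \<open>auto simp: flat_exp_def\<close>)
    thus ?thesis using 1 by (simp add: flat_exp_def)
  next
    case 2
    have "\<forall>\<^sub>F h in at 0. flat_exp (Suc j) h = (flat_exp j (0 + h) - flat_exp j 0) / h"
      by (auto simp: eventually_at_filter flat_exp_def)
    hence "((\<lambda>h. (flat_exp j (0 + h) - flat_exp j 0) / h) \<longlongrightarrow> 0) (at 0)"
      by (rule Lim_transform_eventually[OF flat_exp_tendsto_0])
    thus ?thesis using 2 by (simp add: DERIV_def flat_exp_def)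
  next
    case 3
    have "((\<lambda>t. (1 / t) ^ j * exp (- (1 / t))) has_real_derivative
        (- real j * flat_exp (Suc j) t + flat_exp (Suc (Suc j)) t)) (at t)"
    proof -
      have d: "((\<lambda>t. 1 / t) has_real_derivative - ((1 / t)\<^sup>2)) (at t)"
        using 3 by (auto intro!: derivative_eq_intros simp: power2_eq_square)
      note d' = DERIV_mult[OF DERIV_power[OF d, of j] DERIV_fun_exp[OF DERIV_minus[OF d]]]
      show ?thesis
        by (rule DERIV_cong[OF d'], cases j)
          (use 3 in \<open>simp_all add: flat_exp_def power2_eq_square algebra_simps add_divide_distrib diff_divide_distrib\<close>)
    qed
    thus ?thesis
      by (rule has_field_derivative_transform_within_open[where S="{0<..}"]) (use 3 in \<open>auto simp: flat_exp_def\<close>)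
  qed
qed

lemma continuously_differentiable_flat_exp:
  "continuously_differentiable k (\<lambda>x::'a::euclidean_space. flat_exp j (1 - c * (x \<bullet> x)))"
proof (induction k arbitrary: j)
  case 0
  have "isCont (flat_exp j) t" for t using DERIV_flat_exp by (rule DERIV_isCont)
  then have "continuous_on UNIV (flat_exp j)" by (simp add: continuous_on_eq_continuous_at)
  then show ?case
    by (auto intro!: continuous_on_compose2[of UNIV "flat_exp j"] continuous_intros)
next
  case (Suc k)
  have q: "((\<lambda>x::'a. 1 - c * (x \<bullet> x)) has_derivative (\<lambda>h. - (2 * c) * (x \<bullet> h))) (at x)" for x
    by (auto intro!: derivative_eq_intros simp: inner_commute)
  show ?case
  proof (rule continuously_differentiable_SucI)
    fix x :: 'a
    show "((\<lambda>x. flat_exp j (1 - c * (x \<bullet> x))) has_derivative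
      (\<lambda>h. (- real j * flat_exp (Suc j) (1 - c * (x \<bullet> x)) + flat_exp (Suc (Suc j)) (1 - c * (x \<bullet> x)))
          * (- (2 * c) * (x \<bullet> h)))) (at x)"
      using has_derivative_compose[OF q DERIV_flat_exp[unfolded has_field_derivative_def]] by simp
  next
    fix b :: 'a
    show "continuously_differentiable k (\<lambda>x. (- real j * flat_exp (Suc j) (1 - c * (x \<bullet> x)) + flat_exp (Suc (Suc j)) (1 - c * (x \<bullet> x)))
          * (- (2 * c) * (x \<bullet> b)))"
      by (intro continuously_differentiable_mult continuously_differentiable_add
          continuously_differentiable_const continuously_differentiable_inner_const Suc.IH)
  qed
qed

lemma continuously_differentiable_measurable:
  "continuously_differentiable k f \<Longrightarrow> f \<in> borel_measurable borel"
proof (induction k)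
  case 0
  then show ?case by (simp add: borel_measurable_continuous_onI)
next
  case (Suc k)
  show ?case by (rule Suc.IH[OF continuously_differentiable_Suc_imp[OF Suc.prems]])
qed

text \<open>
  The upper bound measures \<open>R\<close> against the ball of radius \<open>2 * \<delta>\<close> because a function cut off to that ball
  will be paired with \<open>R\<close>; what matters is that \<open>C\<close> can be chosen independently of \<open>\<delta>\<close>.
\<close>

definition mollifier :: "real \<Rightarrow> real \<Rightarrow> ('a::euclidean_space \<Rightarrow> real) \<Rightarrow> bool" where
  "mollifier C \<delta> R \<longleftrightarrow>
     (\<forall>k. continuously_differentiable k R) \<and> (\<forall>x. 0 \<le> R x) \<and> (\<forall>x. x \<notin> ball 0 \<delta> \<longrightarrow> R x = 0) \<and>
     integrable lborel R \<and> (LINT x|lborel. R x) = 1 \<and>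
     (\<forall>x. R x \<le> C / measure lborel (ball (0::'a) (2 * \<delta>)))"

text \<open>
  Normalise \<open>f x = exp (- 1 / (1 - (norm x / \<delta>)^2))\<close>. It is at most \<open>exp (- 1)\<close>, and at least \<open>exp (- 4/3)\<close> on the
  ball of radius \<open>\<delta>/2\<close>, so its integral is at least a fixed multiple of the volume of that ball.
\<close>

lemma mollifier_exists:
  obtains C where "C > 0" "\<And>\<delta>. \<delta> > 0 \<Longrightarrow> \<exists>R::'a::euclidean_space \<Rightarrow> real. mollifier C \<delta> R"
proof
  let ?C = "exp (- 1) / exp (- (4/3)) * 4 ^ DIM('a) :: real"
  show "?C > 0" by simp
  fix \<delta> :: real assume d: "\<delta> > 0"
  define f where "f x = flat_exp 0 (1 - (1 / \<delta>\<^sup>2) * (x \<bullet> x))" for x :: 'a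
  have q: "1 - (1 / \<delta>\<^sup>2) * (x \<bullet> x) = 1 - (norm x / \<delta>)\<^sup>2" for x :: 'a
    by (simp add: power2_norm_eq_inner power_divide)
  have fq: "f x = flat_exp 0 (1 - (norm x / \<delta>)\<^sup>2)" for x
    unfolding f_def q ..
  have smooth: "continuously_differentiable k f" for k
    unfolding f_def by (rule continuously_differentiable_flat_exp)
  have [measurable]: "f \<in> borel_measurable borel"
    using smooth by (rule continuously_differentiable_measurable)
  have f0: "f x \<ge> 0" for x by (simp add: f_def flat_exp_def)
  have fsupp: "f x = 0" if "x \<notin> ball 0 \<delta>" for x
  proof -
    have "1 \<le> norm x / \<delta>" using that d by simp
    hence "1 \<le> (norm x / \<delta>)\<^sup>2" by (rule one_le_power)
    thus ?thesis by (simp add: fq flat_exp_def)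
  qed
  have fub: "f x \<le> exp (- 1)" for x
  proof (cases "1 - (norm x / \<delta>)\<^sup>2 > 0")
    case True
    have "1 \<le> 1 / (1 - (norm x / \<delta>)\<^sup>2)" using True by simp
    thus ?thesis using True by (simp add: fq flat_exp_def)
  qed (simp add: fq flat_exp_def)
  have flb: "exp (- (4/3)) \<le> f x" if "x \<in> ball 0 (\<delta>/2)" for x
  proof -
    have "norm x / \<delta> \<le> 1/2" using that d by (simp add: field_simps)
    hence "(norm x / \<delta>)\<^sup>2 \<le> (1/2)\<^sup>2" using d by (intro power_mono) auto
    hence a: "3/4 \<le> 1 - (norm x / \<delta>)\<^sup>2" by (simp add: power2_eq_square)
    hence "1 / (1 - (norm x / \<delta>)\<^sup>2) \<le> 4/3" by (simp add: field_simps)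
    thus ?thesis using a by (simp add: fq flat_exp_def)
  qed
  have int: "integrable lborel f"
    by (rule integrableI_bounded_set[where A="ball 0 \<delta>" and B="exp (-1)"])
      (use f0 fub fsupp emeasure_lborel_ball_finite in auto)
  define I where "I = (LINT x|lborel. f x)"
  define b where "b = measure lborel (ball (0::'a) (\<delta>/2))"
  have b0: "b > 0" using d by (simp add: b_def content_ball_pos)
  have ib: "integrable lborel (\<lambda>x::'a. exp (- (4/3)) * indicator (ball 0 (\<delta>/2)) x :: real)"
    using emeasure_lborel_ball_finite by (intro integrable_mult_right integrable_real_indicator) auto
  have "exp (- (4/3)) * b = (LINT x::'a|lborel. exp (- (4/3)) * indicator (ball 0 (\<delta>/2)) x)"
    by (simp add: b_def)
  also have "\<dots> \<le> I"
    unfolding I_def by (rule integral_mono[OF ib int]) (use flb f0 in \<open>auto simp: indicator_def\<close>)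
  finally have I: "exp (- (4/3)) * b \<le> I" .
  hence I0: "I > 0" using b0 by (smt (verit) exp_gt_zero mult_pos_pos)
  have four: "(4::real) ^ n = 2 ^ n * 2 ^ n" for n
    by (simp flip: power_mult_distrib)
  have b4: "measure lborel (ball (0::'a) (2*\<delta>)) = 4 ^ DIM('a) * b"
    using content_ball_conv_unit_ball[of "\<delta>/2" "0::'a"] content_ball_conv_unit_ball[of "2*\<delta>" "0::'a"] d
      four by (simp add: b_def power_mult_distrib power_divide)
  show "\<exists>R::'a \<Rightarrow> real. mollifier ?C \<delta> R"
    unfolding mollifier_def
  proof (intro exI[of _ "\<lambda>x. (1/I) * f x"] conjI allI impI)
    show "continuously_differentiable k (\<lambda>x. (1/I) * f x)" for k
      by (intro continuously_differentiable_mult continuously_differentiable_const smooth)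
    show "0 \<le> (1/I) * f x" for x using f0 I0 by simp
    show "x \<notin> ball 0 \<delta> \<Longrightarrow> (1/I) * f x = 0" for x using fsupp by simp
    show "integrable lborel (\<lambda>x. (1/I) * f x)" using int by simp
    have "(LINT x|lborel. (1/I) * f x) = (1/I) * I"
      by (subst integral_mult_right_zero) (simp only: I_def)
    thus "(LINT x|lborel. (1/I) * f x) = 1" using I0 by simp
    fix x
    have "(1/I) * f x \<le> 1 / (exp (- (4/3)) * b) * exp (- 1)"
      using I0 b0 I f0 fub by (intro mult_mono divide_left_mono) auto
    thus "(1/I) * f x \<le> ?C / measure lborel (ball (0::'a) (2*\<delta>))"
      unfolding b4 by (simp add: field_simps)
  qed
qed

section \<open>Convolution\<close>

lemma frechet_derivative_outside_support:
  assumes "closed S" "\<And>y. y \<notin> S \<Longrightarrow> f y = 0" "x \<notin> S"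
  shows "frechet_derivative f (at x) = (\<lambda>_. 0)"
proof -
  have "((\<lambda>_. 0) has_derivative (\<lambda>_. 0)) (at x)" by simp
  hence "(f has_derivative (\<lambda>_. 0)) (at x)"
    by (rule has_derivative_transform_within_open[where s="- S"]) (use assms in auto)
  thus ?thesis by (simp add: frechet_derivative_at[symmetric])
qed

lemma compact_support_bounded:
  fixes f :: "'a::euclidean_space \<Rightarrow> 'b::real_normed_vector"
  assumes "continuous_on UNIV f" "\<And>x. x \<notin> cball 0 \<rho> \<Longrightarrow> f x = 0"
  obtains L where "L \<ge> 0" "\<And>x. norm (f x) \<le> L"
proof -
  have "bounded (f ` cball 0 \<rho>)"
    by (intro compact_imp_bounded compact_continuous_image continuous_on_subset[OF assms(1)]) auto
  then obtain L where L: "\<And>x. x \<in> cball 0 \<rho> \<Longrightarrow> norm (f x) \<le> L"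
    unfolding bounded_iff by blast
  have "norm (f x) \<le> max L 0" for x
    using L[of x] assms(2)[of x] by (cases "x \<in> cball 0 \<rho>") (auto simp del: mem_cball)
  with that[of "max L 0"] show thesis by simp
qed

lemma compact_support_lipschitz:
  fixes f :: "'a::euclidean_space \<Rightarrow> 'b::real_normed_vector"
  assumes f: "continuously_differentiable (Suc 0) f" and supp: "\<And>x. x \<notin> cball 0 \<rho> \<Longrightarrow> f x = 0"
  obtains L where "L \<ge> 0" "\<And>x y. norm (f x - f y) \<le> L * norm (x - y)"
proof -
  note d = continuously_differentiable_SucD[OF f]
  have d0: "frechet_derivative f (at x) b = 0" if "x \<notin> cball 0 \<rho>" for x b
    using frechet_derivative_outside_support[of "cball 0 \<rho>" f x] supp that by simp
  have "\<exists>L\<ge>0. \<forall>x. norm (frechet_derivative f (at x) b) \<le> L" if b: "b \<in> Basis" for b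
    by (rule compact_support_bounded[of "\<lambda>x. frechet_derivative f (at x) b" \<rho>])
      (use d(2)[OF b] d0 in auto)
  then obtain L where L: "\<And>b x. b \<in> Basis \<Longrightarrow> L b \<ge> 0 \<and> norm (frechet_derivative f (at x) b) \<le> L b"
    by metis
  show thesis
  proof (rule that[of "\<Sum>b\<in>Basis. L b"])
    show "(\<Sum>b\<in>Basis. L b) \<ge> 0" using L by (simp add: sum_nonneg)
    fix x y
    have on: "onorm (frechet_derivative f (at z)) \<le> (\<Sum>b\<in>Basis. L b)" for z
      by (rule order_trans[OF onorm_componentwise[OF has_derivative_bounded_linear[OF d(1)]]])
        (use L in \<open>auto intro: sum_mono\<close>)
    show "norm (f x - f y) \<le> (\<Sum>b\<in>Basis. L b) * norm (x - y)"
      by (rule differentiable_bound[where S=UNIV and f'="\<lambda>z. frechet_derivative f (at z)"])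
         (use d(1) on in auto)
  qed
qed

text \<open>
  A remainder estimate that is uniform in \<open>x\<close> is what survives integration in \<open>convolution_smooth\<close>; it
  comes from the partial derivatives being Lipschitz, as they are again compactly supported.
\<close>

lemma compact_support_taylor:
  fixes f :: "'a::euclidean_space \<Rightarrow> 'b::real_normed_vector"
  assumes f: "continuously_differentiable (Suc (Suc 0)) f" and supp: "\<And>x. x \<notin> cball 0 \<rho> \<Longrightarrow> f x = 0"
  obtains L where "L \<ge> 0"
    "\<And>x h. norm (f (x + h) - f x - frechet_derivative f (at x) h) \<le> L * (norm h)\<^sup>2"
proof -
  note d = continuously_differentiable_SucD[OF f]
  have d0: "frechet_derivative f (at x) b = 0" if "x \<notin> cball 0 \<rho>" for x b
    using frechet_derivative_outside_support[of "cball 0 \<rho>" f x] supp that by simp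
  have "\<exists>L\<ge>0. \<forall>x y. norm (frechet_derivative f (at x) b - frechet_derivative f (at y) b) \<le> L * norm (x - y)"
    if b: "b \<in> Basis" for b
    by (rule compact_support_lipschitz[of "\<lambda>x. frechet_derivative f (at x) b" \<rho>])
      (use d(2)[OF b] d0 in \<open>auto simp del: continuously_differentiable.simps\<close>)
  then obtain L where L: "\<And>b x y. b \<in> Basis \<Longrightarrow> L b \<ge> 0 \<and> norm (frechet_derivative f (at x) b - frechet_derivative f (at y) b) \<le> L b * norm (x - y)"
    by metis
  show thesis
  proof (rule that[of "\<Sum>b\<in>Basis. L b"])
    show L0: "(\<Sum>b\<in>Basis. L b) \<ge> 0" using L by (simp add: sum_nonneg)
    fix x h
    have on: "onorm (frechet_derivative f (at z) - frechet_derivative f (at x)) \<le> (\<Sum>b\<in>Basis. L b) * norm h"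
      if z: "z \<in> closed_segment x (x + h)" for z
    proof -
      have bl: "bounded_linear (frechet_derivative f (at z) - frechet_derivative f (at x))"
        unfolding fun_diff_def by (intro bounded_linear_sub has_derivative_bounded_linear[OF d(1)])
      have zx: "norm (z - x) \<le> norm h"
        using segment_bound1[OF z] by (simp add: norm_minus_commute)
      have "onorm (frechet_derivative f (at z) - frechet_derivative f (at x))
         \<le> (\<Sum>b\<in>Basis. norm (frechet_derivative f (at z) b - frechet_derivative f (at x) b))"
        using onorm_componentwise[OF bl] by simp
      also have "\<dots> \<le> (\<Sum>b\<in>Basis. L b * norm h)"
        using L zx by (intro sum_mono) (meson mult_left_mono order_trans)
      finally show ?thesis by (simp add: sum_distrib_right)
    qed
    have "norm (f (x + h) - f x - frechet_derivative f (at x) ((x + h) - x)) \<le> norm ((x + h) - x) * ((\<Sum>b\<in>Basis. L b) * norm h)"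
    proof (rule differentiable_bound_linearization[where S="closed_segment x (x + h)"])
      show "x + t *\<^sub>R (x + h - x) \<in> closed_segment x (x + h)" if "t \<in> {0..1}" for t
        using that unfolding closed_segment_def by (auto intro!: exI[of _ t] simp: algebra_simps)
      show "(f has_derivative frechet_derivative f (at z)) (at z within closed_segment x (x + h))" for z
        using d(1) by (rule has_derivative_at_withinI)
    qed (use on in auto)
    thus "norm (f (x + h) - f x - frechet_derivative f (at x) h) \<le> (\<Sum>b\<in>Basis. L b) * (norm h)\<^sup>2"
      by (simp add: power2_eq_square mult_ac)
  qed
qed

definition convolution :: "('a::euclidean_space \<Rightarrow> complex) \<Rightarrow> ('a \<Rightarrow> complex) \<Rightarrow> 'a \<Rightarrow> complex" where
  "convolution P R x = (LINT y|lborel. P y * R (x - y))"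

lemma integrable_mult_bounded:
  fixes P R :: "'a::euclidean_space \<Rightarrow> complex"
  assumes P: "integrable lborel P" and R[measurable]: "R \<in> borel_measurable borel" and b: "\<And>x. norm (R x) \<le> L"
  shows "integrable lborel (\<lambda>y. P y * R (x - y))"
proof -
  have [measurable]: "P \<in> borel_measurable borel" using P by auto
  have L: "L \<ge> 0" using b[of 0] norm_ge_zero order_trans by blast
  show ?thesis
  proof (rule Bochner_Integration.integrable_bound[where f="\<lambda>y. L * norm (P y)"])
    show "integrable lborel (\<lambda>y. L * norm (P y))" using P by simp
    show "(\<lambda>y. P y * R (x - y)) \<in> borel_measurable lborel" by measurable
    show "AE y in lborel. norm (P y * R (x - y)) \<le> norm (L * norm (P y))"
    proof (rule AE_I2)
      fix y
      show "norm (P y * R (x - y)) \<le> norm (L * norm (P y))"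
        using mult_left_mono[OF b[of "x - y"] norm_ge_zero[of "P y"]] L by (simp add: norm_mult mult.commute)
    qed
  qed
qed

text \<open>
  Differentiation falls on \<open>R\<close>, so an induction on the order of differentiability works with \<open>P\<close> fixed and
  merely integrable: the uniform quadratic remainder of \<open>R\<close>, integrated against \<open>|P|\<close>, shows that the
  partial derivatives of the convolution are the convolutions with those of \<open>R\<close>.
\<close>

lemma convolution_smooth:
  fixes P R :: "'a::euclidean_space \<Rightarrow> complex"
  assumes P: "integrable lborel P"
  shows "(\<And>k. continuously_differentiable k R) \<Longrightarrow> (\<And>x. x \<notin> cball 0 \<rho> \<Longrightarrow> R x = 0) \<Longrightarrow>
    continuously_differentiable k (convolution P R)"
proof (induction k arbitrary: R)
  case (0 R)
  obtain L where L: "L \<ge> 0" "\<And>x y. norm (R x - R y) \<le> L * norm (x - y)"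
    using compact_support_lipschitz[of R \<rho>, OF "0.prems"] by blast
  have cont: "continuous_on UNIV R" using "0.prems"(1)[of 0] by simp
  then obtain D where D: "\<And>x. norm (R x) \<le> D" using compact_support_bounded[of R \<rho>, OF _ "0.prems"(2)] by blast
  note i = integrable_mult_bounded[OF P borel_measurable_continuous_onI[OF cont] D]
  define N where "N = (LINT y|lborel. norm (P y))"
  have lip: "norm (convolution P R x - convolution P R x') \<le> (N * L) * norm (x - x')" for x x'
  proof -
    have "convolution P R x - convolution P R x' = (LINT y|lborel. P y * (R (x - y) - R (x' - y)))"
      unfolding convolution_def right_diff_distrib by (rule Bochner_Integration.integral_diff[symmetric]) (rule i)+
    also have "norm \<dots> \<le> (LINT y|lborel. norm (P y) * (L * norm (x - x')))"
    proof (rule order_trans[OF integral_norm_bound], rule integral_mono)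
      show "integrable lborel (\<lambda>y. norm (P y * (R (x - y) - R (x' - y))))"
        unfolding right_diff_distrib by (intro integrable_norm Bochner_Integration.integrable_diff i)
      show "norm (P y * (R (x - y) - R (x' - y))) \<le> norm (P y) * (L * norm (x - x'))" for y
        using L(2)[of "x - y" "x' - y"] by (auto simp: norm_mult intro!: mult_left_mono)
    qed (use P in simp)
    finally show ?thesis by (simp add: N_def mult_ac)
  qed
  have "(N * L)-lipschitz_on UNIV (convolution P R)"
    using lip L(1) by (intro lipschitz_onI) (auto simp: dist_norm N_def)
  thus ?case by (simp add: lipschitz_on_continuous_on)
next
  case (Suc k R)
  note d = continuously_differentiable_SucD[OF Suc.prems(1)]
  define dR where "dR b x = frechet_derivative R (at x) b" for b x
  have dRC: "continuously_differentiable j (dR b)" if "b \<in> Basis" for j b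
    unfolding dR_def by (rule d(2)[OF that])
  have dR0: "dR b x = 0" if "x \<notin> cball 0 \<rho>" for b x
    unfolding dR_def using frechet_derivative_outside_support[of "cball 0 \<rho>" R x] Suc.prems(2) that by simp
  have R': "frechet_derivative R (at x) h = (\<Sum>b\<in>Basis. (h \<bullet> b) *\<^sub>R dR b x)" for x h
  proof -
    interpret bounded_linear "frechet_derivative R (at x)" using d(1) by (rule has_derivative_bounded_linear)
    have "frechet_derivative R (at x) h = frechet_derivative R (at x) (\<Sum>b\<in>Basis. (h \<bullet> b) *\<^sub>R b)"
      by (simp add: euclidean_representation)
    thus ?thesis by (simp add: sum scale dR_def)
  qed
  obtain L where L: "L \<ge> 0" "\<And>x h. norm (R (x + h) - R x - frechet_derivative R (at x) h) \<le> L * (norm h)\<^sup>2"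
    using compact_support_taylor[of R \<rho>, OF Suc.prems] by blast
  have int: "integrable lborel (\<lambda>y. P y * f (x - y))"
    if f: "continuously_differentiable 0 f" "\<And>x. x \<notin> cball 0 \<rho> \<Longrightarrow> f x = 0" for f x
  proof -
    have cont: "continuous_on UNIV f" using f(1) by simp
    then obtain D where "\<And>x. norm (f x) \<le> D" using compact_support_bounded[of f \<rho>, OF _ f(2)] by blast
    thus ?thesis by (rule integrable_mult_bounded[OF P borel_measurable_continuous_onI[OF cont]])
  qed
  note iR = int[OF Suc.prems]
  have idR: "integrable lborel (\<lambda>y. P y * dR b (x - y))" if "b \<in> Basis" for b x
    by (rule int[OF dRC[OF that] dR0])
  define N where "N = (LINT y|lborel. norm (P y))"
  define D where "D x h = (\<Sum>b\<in>Basis. (h \<bullet> b) *\<^sub>R convolution P (dR b) x)" for x h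
  have Dlin: "bounded_linear (D x)" for x
    unfolding D_def by (intro bounded_linear_sum bounded_linear_scaleR_const bounded_linear_inner_left)
  have Dint: "D x h = (LINT y|lborel. P y * frechet_derivative R (at (x - y)) h)"
    and iD: "integrable lborel (\<lambda>y. P y * frechet_derivative R (at (x - y)) h)" for x h
  proof -
    have eq: "P y * frechet_derivative R (at (x - y)) h = (\<Sum>b\<in>Basis. (h \<bullet> b) *\<^sub>R (P y * dR b (x - y)))" for y
      by (simp add: R' sum_distrib_left)
    show "D x h = (LINT y|lborel. P y * frechet_derivative R (at (x - y)) h)"
      unfolding eq using idR by (subst Bochner_Integration.integral_sum) (auto simp: D_def convolution_def)
    show "integrable lborel (\<lambda>y. P y * frechet_derivative R (at (x - y)) h)"
      unfolding eq using idR by (intro Bochner_Integration.integrable_sum integrable_scaleR_right) auto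
  qed
  have quad: "norm (convolution P R (x + h) - convolution P R x - D x h) \<le> (N * L) * (norm h)\<^sup>2" for x h
  proof -
    let ?f = "\<lambda>y. P y * (R ((x - y) + h) - R (x - y) - frechet_derivative R (at (x - y)) h)"
    have eq: "?f y = P y * R ((x + h) - y) - P y * R (x - y) - P y * frechet_derivative R (at (x - y)) h" for y
      by (simp add: algebra_simps)
    have i: "integrable lborel ?f"
      unfolding eq by (intro Bochner_Integration.integrable_diff iR iD)
    have "(LINT y|lborel. ?f y) = (LINT y|lborel. P y * R ((x + h) - y) - P y * R (x - y))
        - (LINT y|lborel. P y * frechet_derivative R (at (x - y)) h)"
      unfolding eq by (rule Bochner_Integration.integral_diff[OF Bochner_Integration.integrable_diff[OF iR iR] iD])
    also have "(LINT y|lborel. P y * R ((x + h) - y) - P y * R (x - y)) = convolution P R (x + h) - convolution P R x"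
      unfolding convolution_def by (rule Bochner_Integration.integral_diff[OF iR iR])
    finally have "convolution P R (x + h) - convolution P R x - D x h = (LINT y|lborel. ?f y)"
      unfolding Dint by (rule sym)
    also have "norm \<dots> \<le> (LINT y|lborel. norm (P y) * (L * (norm h)\<^sup>2))"
    proof (rule order_trans[OF integral_norm_bound], rule integral_mono)
      show "integrable lborel (\<lambda>y. norm (?f y))" using i by (rule integrable_norm)
      show "norm (?f y) \<le> norm (P y) * (L * (norm h)\<^sup>2)" for y
        unfolding norm_mult by (intro mult_left_mono L(2)) auto
    qed (use P in simp)
    finally show ?thesis by (simp add: N_def mult_ac)
  qed
  have NL: "N * L \<ge> 0" using L(1) by (simp add: N_def)
  have der: "(convolution P R has_derivative D x) (at x)" for x
  proof (rule has_derivativeI_sandwich[where e=1 and H="\<lambda>y. (N * L) * norm (y - x)"])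
    fix y assume "y \<noteq> x"
    hence "norm (y - x) > 0" by simp
    thus "norm (convolution P R y - convolution P R x - D x (y - x)) / norm (y - x) \<le> (N * L) * norm (y - x)"
      using quad[of x "y - x"] by (simp add: field_simps power2_eq_square)
  next
    have "((\<lambda>y. (N * L) * norm (y - x)) \<longlongrightarrow> (N * L) * norm (x - x)) (at x)"
      by (intro tendsto_intros)
    thus "((\<lambda>y. (N * L) * norm (y - x)) \<longlongrightarrow> 0) (at x)" by simp
  qed (use Dlin in auto)
  show ?case
  proof (rule continuously_differentiable_SucI[OF der])
    fix b :: 'a assume b: "b \<in> Basis"
    have "(\<lambda>x. D x b) = convolution P (dR b)"
    proof
      fix x
      have "D x b = (LINT y|lborel. P y * dR b (x - y))" unfolding Dint dR_def ..
      thus "D x b = convolution P (dR b) x" by (simp add: convolution_def)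
    qed
    thus "continuously_differentiable k (\<lambda>x. D x b)"
      using Suc.IH[of "dR b"] dRC[OF b] dR0 by simp
  qed
qed

lemma lborel_integral_reflect:
  fixes f :: "'a::euclidean_space \<Rightarrow> 'b::{banach, second_countable_topology}"
  assumes [measurable]: "f \<in> borel_measurable borel"
  shows "(LINT x|lborel. f (- x)) = (LINT x|lborel. f x)"
proof -
  have "density (distr lborel borel (\<lambda>x::'a. 0 + (- 1) *\<^sub>R x)) (\<lambda>_. ennreal (\<bar>- 1 :: real\<bar> ^ DIM('a))) = lborel"
    by (rule lborel_affine[symmetric]) simp
  hence "distr lborel borel (uminus :: 'a \<Rightarrow> 'a) = lborel" by (simp add: density_1)
  hence "(LINT x|lborel. f x) = (LINT x|distr lborel borel uminus. f x)" by simp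
  also have "\<dots> = (LINT x|lborel. f (- x))"
    by (rule integral_distr) auto
  finally show ?thesis ..
qed

lemma convolution_integrable_pair:
  fixes P R :: "'a::euclidean_space \<Rightarrow> complex"
  assumes P: "integrable lborel P" and R: "integrable lborel R"
  shows "integrable (lborel \<Otimes>\<^sub>M lborel) (\<lambda>(y, x). P y * R (x - y))"
proof (rule lborel_pair.Fubini_integrable)
  have [measurable]: "P \<in> borel_measurable borel" "R \<in> borel_measurable borel" using P R by auto
  show "(\<lambda>(y, x). P y * R (x - y)) \<in> borel_measurable (lborel \<Otimes>\<^sub>M lborel)"
    by (simp add: case_prod_beta)
  have tr: "(LINT x|lborel. norm (R (x - y))) = (LINT x|lborel. norm (R x))" for y
    using lborel_integral_translate[of "\<lambda>x. norm (R x)" "- y"] by simp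
  show "integrable lborel (\<lambda>y. LINT x|lborel. norm (case (y, x) of (y, x) \<Rightarrow> P y * R (x - y)))"
    using P by (simp add: norm_mult tr)
  have "integrable lborel (\<lambda>x. R (x - y))" for y
  proof -
    have "integrable (distr lborel borel ((+) (- y))) R" using R by (simp add: lborel_distr_plus)
    hence "integrable lborel (\<lambda>x. R (- y + x))" by (subst (asm) integrable_distr_eq) auto
    thus ?thesis by simp
  qed
  thus "AE y in lborel. integrable lborel (\<lambda>x. case (y, x) of (y, x) \<Rightarrow> P y * R (x - y))"
    by simp
qed

lemma fourier_transform_convolution:
  fixes P R :: "'a::euclidean_space \<Rightarrow> complex"
  assumes P: "integrable lborel P" and R: "integrable lborel R"
  shows "fourier_transform lborel (convolution P R) l = fourier_transform lborel P l * fourier_transform lborel R l"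
proof -
  have [measurable]: "P \<in> borel_measurable borel" "R \<in> borel_measurable borel" using P R by auto
  have i: "integrable (lborel \<Otimes>\<^sub>M lborel) (\<lambda>(y, x). character l x * (P y * R (x - y)))"
  proof (rule Bochner_Integration.integrable_bound[OF convolution_integrable_pair[OF P R]])
    show "(\<lambda>(y, x). character l x * (P y * R (x - y))) \<in> borel_measurable (lborel \<Otimes>\<^sub>M lborel)"
      by (simp add: case_prod_beta)
  qed (simp add: case_prod_beta norm_mult)
  have "fourier_transform lborel (convolution P R) l = (LINT x|lborel. LINT y|lborel. character l x * (P y * R (x - y)))"
    unfolding fourier_transform_character convolution_def by (subst integral_mult_right_zero) simp
  also have "\<dots> = (LINT y|lborel. LINT x|lborel. character l x * (P y * R (x - y)))"
    by (rule lborel_pair.Fubini_integral[OF i])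
  also have "\<dots> = (LINT y|lborel. (character l y * P y) * fourier_transform lborel R l)"
  proof (rule Bochner_Integration.integral_cong[OF refl])
    fix y
    have "(LINT x|lborel. character l x * (P y * R (x - y)))
        = (LINT x|lborel. (character l y * P y) * (character l (- y + x) * R (- y + x)))"
    proof (rule Bochner_Integration.integral_cong[OF refl])
      fix x
      have "character l (y + (- y + x)) = character l y * character l (- y + x)" by (rule character_add)
      thus "character l x * (P y * R (x - y)) = (character l y * P y) * (character l (- y + x) * R (- y + x))"
        by (simp add: mult_ac)
    qed
    also have "\<dots> = (character l y * P y) * fourier_transform lborel R l"
      unfolding fourier_transform_character
      by (subst integral_mult_right_zero, subst lborel_integral_translate[of "\<lambda>x. character l x * R x"]) auto
    finally show "(LINT x|lborel. character l x * (P y * R (x - y))) = (character l y * P y) * fourier_transform lborel R l" .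
  qed
  also have "\<dots> = fourier_transform lborel P l * fourier_transform lborel R l"
    by (simp only: integral_mult_left_zero fourier_transform_character)
  finally show ?thesis .
qed

lemma fourier_transform_diff:
  fixes f g :: "'a::euclidean_space \<Rightarrow> complex"
  assumes "integrable lborel f" "integrable lborel g"
  shows "fourier_transform lborel (\<lambda>x. f x - g x) l = fourier_transform lborel f l - fourier_transform lborel g l"
  unfolding fourier_transform_character right_diff_distrib
  by (intro Bochner_Integration.integral_diff integrable_character_mult assms) auto

lemma norm_character_minus_1: "norm (character \<xi> x - 1) \<le> 2 * pi * norm \<xi> * norm x"
proof -
  have "character \<xi> x = exp (\<i> * of_real (- (2 * pi * (\<xi> \<bullet> x))))"
    by (simp add: character_def mult_ac)
  hence "norm (character \<xi> x - 1) = 2 * \<bar>sin (- (2 * pi * (\<xi> \<bullet> x)) / 2)\<bar>"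
    by (simp only: dist_exp_i_1)
  also have "\<dots> \<le> 2 * \<bar>- (2 * pi * (\<xi> \<bullet> x)) / 2\<bar>"
    by (intro mult_left_mono abs_sin_x_le_abs_x) auto
  also have "\<dots> = 2 * pi * \<bar>\<xi> \<bullet> x\<bar>" by (simp add: abs_mult)
  also have "\<dots> \<le> 2 * pi * (norm \<xi> * norm x)"
    by (intro mult_left_mono Cauchy_Schwarz_ineq2) auto
  finally show ?thesis by (simp add: mult_ac)
qed

lemma fourier_transform_mollifier:
  fixes R :: "'a::euclidean_space \<Rightarrow> real"
  assumes R: "mollifier C \<delta> R"
  shows "norm (fourier_transform lborel (\<lambda>x. of_real (R x)) l - 1) \<le> 2 * pi * norm l * \<delta>"
    and "norm (fourier_transform lborel (\<lambda>x. of_real (R x)) l) \<le> 1"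
proof -
  have R0: "0 \<le> R x" and supp: "x \<notin> ball 0 \<delta> \<Longrightarrow> R x = 0" for x
    using R by (simp_all add: mollifier_def)
  have int: "integrable lborel R" and one: "(LINT x|lborel. R x) = 1"
    using R by (simp_all add: mollifier_def)
  let ?R = "\<lambda>x. complex_of_real (R x)"
  have i: "integrable lborel ?R" using int by simp
  have ic: "integrable lborel (\<lambda>x. character l x * ?R x)"
    by (rule integrable_character_mult[OF i]) simp
  have "fourier_transform lborel ?R l - 1 = (LINT x|lborel. character l x * ?R x) - (LINT x|lborel. ?R x)"
    using one by (simp add: fourier_transform_character)
  also have "\<dots> = (LINT x|lborel. character l x * ?R x - ?R x)"
    by (rule Bochner_Integration.integral_diff[OF ic i, symmetric])
  also have "norm \<dots> \<le> (LINT x|lborel. (2 * pi * norm l * \<delta>) * R x)"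
  proof (rule order_trans[OF integral_norm_bound], rule integral_mono)
    show "integrable lborel (\<lambda>x. norm (character l x * ?R x - ?R x))"
      by (intro integrable_norm Bochner_Integration.integrable_diff ic i)
    show "integrable lborel (\<lambda>x. (2 * pi * norm l * \<delta>) * R x)" using int by simp
    fix x
    show "norm (character l x * ?R x - ?R x) \<le> (2 * pi * norm l * \<delta>) * R x"
    proof (cases "x \<in> ball 0 \<delta>")
      case True
      have "norm (character l x * ?R x - ?R x) = norm (character l x - 1) * R x"
      proof -
        have "character l x * ?R x - ?R x = (character l x - 1) * ?R x" by (simp add: algebra_simps)
        thus ?thesis using R0[of x] by (simp add: norm_mult)
      qed
      also have "\<dots> \<le> (2 * pi * norm l * norm x) * R x"
        by (intro mult_right_mono norm_character_minus_1 R0)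
      also have "\<dots> \<le> (2 * pi * norm l * \<delta>) * R x"
        using True by (intro mult_right_mono mult_left_mono R0) auto
      finally show ?thesis .
    qed (simp add: supp)
  qed
  also have "\<dots> = 2 * pi * norm l * \<delta>" using one by simp
  finally show "norm (fourier_transform lborel ?R l - 1) \<le> 2 * pi * norm l * \<delta>" .
  have "norm (fourier_transform lborel ?R l) \<le> (LINT x|lborel. norm (character l x * ?R x))"
    unfolding fourier_transform_character by (rule integral_norm_bound)
  also have "\<dots> = 1" using R0 one by (simp add: norm_mult)
  finally show "norm (fourier_transform lborel ?R l) \<le> 1" .
qed

section \<open>Spectral gaps and singular measures\<close>

lemma convolution_eq_0:
  assumes "\<And>y. P y \<noteq> 0 \<Longrightarrow> R (x - y) = 0"
  shows "convolution P R x = 0"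
proof -
  have "(\<lambda>y. P y * R (x - y)) = (\<lambda>_. 0)"
  proof
    fix y show "P y * R (x - y) = 0" using assms[of y] by (cases "P y = 0") auto
  qed
  thus ?thesis by (simp add: convolution_def)
qed

lemma infsum_diff:
  fixes f g :: "'b \<Rightarrow> 'c::{topological_ab_group_add, t2_space}"
  assumes "f summable_on A" "g summable_on A"
  shows "infsum (\<lambda>x. f x - g x) A = infsum f A - infsum g A"
  using infsum_add[of f A "\<lambda>x. - g x"] assms by (simp add: summable_on_uminus infsum_uminus)

text \<open>
  Let \<open>g\<close> be the restriction of \<open>\<phi>\<close> to the ball of radius \<open>2 * \<delta>\<close>. Since \<open>R\<close> is supported in the ball of radius
  \<open>\<delta>\<close>, the convolution of \<open>\<phi> - g\<close> with \<open>R\<close> vanishes near 0 and is annihilated by the gap. What remains of the sum is the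
  contribution of \<open>g\<close>, where the volumes in the \<open>L^2\<close> norms of \<open>g\<close> and \<open>R\<close> cancel.
\<close>

lemma spectral_gap_mollified_sum_small:
  fixes \<Lambda> :: "'a::euclidean_space set" and \<phi> :: "'a \<Rightarrow> complex" and R :: "'a \<Rightarrow> real"
  assumes bessel: "bessel_on_ball \<Lambda> r \<beta>"
    and gap: "\<And>\<psi>. test_function (ball 0 a - {0}) \<psi> \<Longrightarrow> infsum (fourier_transform lborel \<psi>) \<Lambda> = 0"
    and \<phi>[measurable]: "\<phi> \<in> borel_measurable borel" and \<phi>D: "\<And>x. norm (\<phi> x) \<le> D"
    and \<phi>0: "\<And>x. x \<notin> cball 0 t \<Longrightarrow> \<phi> x = 0"
    and R: "mollifier C \<delta> R"
    and \<delta>: "\<delta> > 0" "2 * \<delta> \<le> r" "t + \<delta> < a" and \<beta>: "\<beta> \<ge> 0"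
    and summ: "(\<lambda>l. norm (fourier_transform lborel \<phi> l * fourier_transform lborel (\<lambda>x. of_real (R x)) l)) summable_on \<Lambda>"
  shows "norm (\<Sum>\<^sub>\<infinity>l\<in>\<Lambda>. fourier_transform lborel \<phi> l * fourier_transform lborel (\<lambda>x. of_real (R x)) l) \<le> \<beta> * (D\<^sup>2 + C) / 2"
proof -
  have smooth: "continuously_differentiable k R" for k
    using R by (simp add: mollifier_def)
  have R0: "0 \<le> R x" and Rsupp: "x \<notin> ball 0 \<delta> \<Longrightarrow> R x = 0"
    and RC: "R x \<le> C / measure lborel (ball (0::'a) (2*\<delta>))" for x
    using R by (simp_all add: mollifier_def)
  have Rint: "integrable lborel R" and Rone: "(LINT x|lborel. R x) = 1"
    using R by (simp_all add: mollifier_def)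
  define V where "V = measure lborel (ball (0::'a) (2*\<delta>))"
  have V: "V > 0" using \<delta> by (simp add: V_def content_ball_pos)
  define Rc where "Rc x = complex_of_real (R x)" for x
  define g where "g x = indicator (ball 0 (2*\<delta>)) x * \<phi> x" for x
  define P where "P x = \<phi> x - g x" for x
  have D0: "D \<ge> 0" using \<phi>D[of 0] norm_ge_zero order_trans by blast
  have [measurable]: "R \<in> borel_measurable borel" using Rint by auto
  have [measurable]: "g \<in> borel_measurable borel"
    unfolding g_def by (intro borel_measurable_times borel_measurable_indicator \<phi>) simp
  have [measurable]: "Rc \<in> borel_measurable borel" unfolding Rc_def by measurable
  have gD: "norm (g x) \<le> D" for x using \<phi>D[of x] D0 by (auto simp: g_def indicator_def)
  have g0: "g x = 0" if "x \<notin> ball 0 r" for x using that \<delta> by (auto simp: g_def indicator_def)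
  have i\<phi>: "integrable lborel \<phi>"
    by (rule integrableI_bounded_set[where A="cball 0 t" and B=D])
      (use \<phi>D \<phi>0 emeasure_lborel_cball_finite in auto)
  have ig: "integrable lborel g"
    by (rule integrableI_bounded_set[where A="cball 0 t" and B=D])
      (use gD \<phi>0 emeasure_lborel_cball_finite in \<open>auto simp: g_def\<close>)
  have iP: "integrable lborel P" unfolding P_def using i\<phi> ig by simp
  have iR: "integrable lborel Rc" unfolding Rc_def using Rint by simp
  have P0: "2 * \<delta> \<le> norm x \<and> norm x \<le> t" if "P x \<noteq> 0" for x
    using that \<phi>0[of x] by (cases "x \<in> ball 0 (2*\<delta>)") (auto simp: P_def g_def)
  have Rc0: "Rc x = 0" if "x \<notin> ball 0 \<delta>" for x using Rsupp[OF that] by (simp add: Rc_def)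
  have test: "test_function (ball 0 a - {0}) (convolution P Rc)"
    unfolding test_function_def
  proof (intro conjI allI)
    show "continuously_differentiable k (convolution P Rc)" for k
    proof (rule convolution_smooth[OF iP])
      show "continuously_differentiable k Rc" for k
        unfolding Rc_def by (rule continuously_differentiable_of_real[OF smooth])
      show "Rc x = 0" if "x \<notin> cball 0 \<delta>" for x
        using that by (intro Rc0) auto
    qed
    have "{x. convolution P Rc x \<noteq> 0} \<subseteq> cball 0 (t + \<delta>) - ball 0 \<delta>"
    proof
      fix x assume "x \<in> {x. convolution P Rc x \<noteq> 0}"
      then obtain y where "P y \<noteq> 0" "Rc (x - y) \<noteq> 0" using convolution_eq_0[of P Rc x] by auto
      hence "2 * \<delta> \<le> norm y" "norm y \<le> t" "norm (x - y) < \<delta>" using P0 Rc0[of "x - y"] by auto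
      thus "x \<in> cball 0 (t + \<delta>) - ball 0 \<delta>"
        using norm_triangle_ineq2[of y x] norm_triangle_ineq2[of x y] by (auto simp: norm_minus_commute)
    qed
    hence sub: "closure {x. convolution P Rc x \<noteq> 0} \<subseteq> cball 0 (t + \<delta>) - ball 0 \<delta>"
      by (rule closure_minimal) (intro closed_Diff closed_cball open_ball)
    thus "compact (closure {x. convolution P Rc x \<noteq> 0})"
      by (metis Diff_subset bounded_cball bounded_subset closed_closure compact_eq_bounded_closed subset_trans)
    show "closure {x. convolution P Rc x \<noteq> 0} \<subseteq> ball 0 a - {0}"
      using sub \<delta> by (auto simp: subset_iff)
  qed
  have FT: "fourier_transform lborel (convolution P Rc) l =
     fourier_transform lborel \<phi> l * fourier_transform lborel Rc l - fourier_transform lborel g l * fourier_transform lborel Rc l" for l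
    unfolding fourier_transform_convolution[OF iP iR] P_def
    by (subst fourier_transform_diff[OF i\<phi> ig]) (simp add: left_diff_distrib)
  have g2: "(LINT x|lborel. (cmod (g x))\<^sup>2) \<le> D\<^sup>2 * V"
  proof -
    have i: "integrable lborel (\<lambda>x::'a. D\<^sup>2 * indicator (ball 0 (2*\<delta>)) x)"
      using emeasure_lborel_ball_finite by (intro integrable_mult_right integrable_real_indicator) auto
    have "(LINT x|lborel. (cmod (g x))\<^sup>2) \<le> (LINT x|lborel. D\<^sup>2 * indicator (ball (0::'a) (2*\<delta>)) x)"
    proof (rule integral_mono'[OF i])
      show "(cmod (g x))\<^sup>2 \<le> D\<^sup>2 * indicator (ball 0 (2*\<delta>)) x" for x
        using \<phi>D[of x] by (cases "x \<in> ball 0 (2*\<delta>)") (auto simp: g_def intro: power_mono)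
    qed simp
    thus ?thesis by (simp add: V_def)
  qed
  have R2: "(LINT x|lborel. (cmod (Rc x))\<^sup>2) \<le> C / V"
  proof -
    have "(LINT x|lborel. (cmod (Rc x))\<^sup>2) \<le> (LINT x|lborel. (C / V) * R x)"
    proof (rule integral_mono')
      show "integrable lborel (\<lambda>x. (C / V) * R x)" using Rint by simp
      show "(cmod (Rc x))\<^sup>2 \<le> (C / V) * R x" for x
        using mult_right_mono[OF RC[of x] R0[of x]] by (simp add: Rc_def V_def power2_eq_square)
      show "0 \<le> (C / V) * R x" for x
        using mult_nonneg_nonneg[OF order_trans[OF R0[of x] RC[of x]] R0[of x]] by (simp add: V_def)
    qed
    thus ?thesis using Rone by simp
  qed
  have Rcb: "norm (Rc x) \<le> C / V" for x using RC[of x] R0[of x] by (simp add: Rc_def V_def)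
  have Rcr: "Rc x = 0" if "x \<notin> ball 0 r" for x using that \<delta> by (intro Rc0) auto
  have bound: "(\<Sum>l\<in>F. norm (fourier_transform lborel g l * fourier_transform lborel Rc l)) \<le> \<beta> * (D\<^sup>2 + C) / 2"
    if F: "finite F" "F \<subseteq> \<Lambda>" for F
  proof -
    let ?g = "\<lambda>l. cmod (fourier_transform lborel g l)" and ?R = "\<lambda>l. cmod (fourier_transform lborel Rc l)"
    have "?g l * ?R l \<le> ((?g l)\<^sup>2 / V + V * (?R l)\<^sup>2) / 2" for l
    proof -
      \<comment> \<open>The weight \<open>V\<close> balances the \<open>L^2\<close> norm of \<open>g\<close>, which is small, against that of \<open>R\<close>, which is large.\<close>
      have "0 \<le> (?g l - V * ?R l)\<^sup>2 / V" using V by simp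
      also have "\<dots> = (?g l)\<^sup>2 / V + V * (?R l)\<^sup>2 - 2 * (?g l * ?R l)"
        using V by (simp add: power2_diff field_simps power2_eq_square)
      finally show ?thesis by simp
    qed
    hence "(\<Sum>l\<in>F. norm (fourier_transform lborel g l * fourier_transform lborel Rc l)) \<le> (\<Sum>l\<in>F. ((?g l)\<^sup>2 / V + V * (?R l)\<^sup>2) / 2)"
      unfolding norm_mult by (intro sum_mono)
    also have "\<dots> = ((\<Sum>l\<in>F. (?g l)\<^sup>2) / V + V * (\<Sum>l\<in>F. (?R l)\<^sup>2)) / 2"
      by (simp only: sum_divide_distrib[symmetric] sum.distrib sum_distrib_left[symmetric])
    also have "\<dots> \<le> ((\<beta> * (D\<^sup>2 * V)) / V + V * (\<beta> * (C / V))) / 2"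
    proof -
      have "(\<Sum>l\<in>F. (?g l)\<^sup>2) \<le> \<beta> * (LINT x|lborel. (cmod (g x))\<^sup>2)"
        by (rule bessel_on_ballD[OF bessel, of g D]) (use gD g0 F in auto)
      also have "\<dots> \<le> \<beta> * (D\<^sup>2 * V)" using g2 \<beta> by (rule mult_left_mono)
      finally have 1: "(\<Sum>l\<in>F. (?g l)\<^sup>2) \<le> \<beta> * (D\<^sup>2 * V)" .
      have "(\<Sum>l\<in>F. (?R l)\<^sup>2) \<le> \<beta> * (LINT x|lborel. (cmod (Rc x))\<^sup>2)"
        by (rule bessel_on_ballD[OF bessel, of Rc "C / V"]) (use Rcb Rcr F in auto)
      also have "\<dots> \<le> \<beta> * (C / V)" using R2 \<beta> by (rule mult_left_mono)
      finally have 2: "(\<Sum>l\<in>F. (?R l)\<^sup>2) \<le> \<beta> * (C / V)" .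
      show ?thesis using V
        by (intro divide_right_mono add_mono mult_left_mono 1 2) auto
    qed
    also have "\<dots> = \<beta> * (D\<^sup>2 + C) / 2" using V by (simp add: field_simps)
    finally show ?thesis .
  qed
  have sg: "(\<lambda>l. norm (fourier_transform lborel g l * fourier_transform lborel Rc l)) summable_on \<Lambda>"
    by (rule nonneg_bounded_partial_sums_imp_summable_on[where C="\<beta> * (D\<^sup>2 + C) / 2"])
      (use bound in \<open>auto intro: eventually_finite_subsets_at_top_weakI\<close>)
  have s1: "(\<lambda>l. fourier_transform lborel \<phi> l * fourier_transform lborel Rc l) summable_on \<Lambda>"
    using summ unfolding Rc_def[symmetric] by (rule Infinite_Sum.abs_summable_summable)
  have s2: "(\<lambda>l. fourier_transform lborel g l * fourier_transform lborel Rc l) summable_on \<Lambda>"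
    using sg by (rule Infinite_Sum.abs_summable_summable)
  have "0 = (\<Sum>\<^sub>\<infinity>l\<in>\<Lambda>. fourier_transform lborel \<phi> l * fourier_transform lborel Rc l - fourier_transform lborel g l * fourier_transform lborel Rc l)"
    using gap[OF test] by (simp add: FT[abs_def])
  also have "\<dots> = (\<Sum>\<^sub>\<infinity>l\<in>\<Lambda>. fourier_transform lborel \<phi> l * fourier_transform lborel Rc l) - (\<Sum>\<^sub>\<infinity>l\<in>\<Lambda>. fourier_transform lborel g l * fourier_transform lborel Rc l)"
    by (rule infsum_diff[OF s1 s2])
  finally have "(\<Sum>\<^sub>\<infinity>l\<in>\<Lambda>. fourier_transform lborel \<phi> l * fourier_transform lborel Rc l) = (\<Sum>\<^sub>\<infinity>l\<in>\<Lambda>. fourier_transform lborel g l * fourier_transform lborel Rc l)"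
    by simp
  also have "norm \<dots> \<le> (\<Sum>\<^sub>\<infinity>l\<in>\<Lambda>. norm (fourier_transform lborel g l * fourier_transform lborel Rc l))"
    by (rule norm_infsum_bound[OF sg])
  also have "\<dots> \<le> \<beta> * (D\<^sup>2 + C) / 2"
    by (rule infsum_le_finite_sums[OF sg bound])
  finally show ?thesis by (simp add: Rc_def[abs_def])
qed

text \<open>
  The function \<open>h\<close> is its own reflected conjugate. Hence \<open>h^\<close> is real, and \<open>convolution h h\<close> is the
  autocorrelation of \<open>h\<close>, with transform \<open>|h^|^2\<close>.
\<close>

lemma modulated_ball_autocorrelation:
  fixes l0 :: "'a::euclidean_space" and s :: real
  assumes h_def: "h = (\<lambda>x. character l0 (- x) * indicator (ball 0 s) x)"
    and b_def: "b = measure lborel (ball (0::'a) s)"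
  shows "h \<in> borel_measurable borel" "integrable lborel h" "norm (h x) \<le> 1" "x \<notin> ball 0 s \<Longrightarrow> h x = 0"
    and "fourier_transform lborel h l0 = of_real b"
    and "convolution h h \<in> borel_measurable borel" "norm (convolution h h x) \<le> b"
    and "x \<notin> cball 0 (2 * s) \<Longrightarrow> convolution h h x = 0"
    and "fourier_transform lborel (convolution h h) l = of_real ((cmod (fourier_transform lborel h l))\<^sup>2)"
proof -
  show hm[measurable]: "h \<in> borel_measurable borel"
    unfolding h_def by (intro borel_measurable_times borel_measurable_indicator) simp_all
  show hb: "norm (h x) \<le> 1" for x by (simp add: h_def norm_mult indicator_def)
  show h0: "x \<notin> ball 0 s \<Longrightarrow> h x = 0" for x by (simp add: h_def)
  show hi: "integrable lborel h"
    by (rule integrableI_bounded_set[where A="ball 0 s" and B=1])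
      (use hb h0 emeasure_lborel_ball_finite in auto)
  have hn: "norm (h x) = indicator (ball 0 s) x" for x by (simp add: h_def norm_mult indicator_def)
  have "fourier_transform lborel h l0 = (LINT x|lborel. of_real (indicator (ball (0::'a) s) x))"
    unfolding fourier_transform_character
    by (rule Bochner_Integration.integral_cong) (simp_all add: h_def mult.assoc[symmetric] indicator_def)
  also have "\<dots> = of_real b"
    by (subst integral_of_real) (auto simp: b_def intro!: integrable_real_indicator emeasure_lborel_ball_finite)
  finally show "fourier_transform lborel h l0 = of_real b" .
  show "convolution h h \<in> borel_measurable borel"
  proof -
    have "(\<lambda>x. LINT y|lborel. h y * h (x - y)) \<in> borel_measurable (borel :: 'a measure)"
      by (rule lborel.borel_measurable_lebesgue_integral) (simp add: case_prod_beta)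
    thus ?thesis by (simp add: convolution_def[abs_def])
  qed
  show "norm (convolution h h x) \<le> b" for x
  proof -
    have i: "integrable lborel (indicator (ball (0::'a) s) :: 'a \<Rightarrow> real)"
      by (auto intro!: integrable_real_indicator emeasure_lborel_ball_finite)
    have "norm (convolution h h x) \<le> (LINT y|lborel. norm (h y * h (x - y)))"
      unfolding convolution_def by (rule integral_norm_bound)
    also have "\<dots> \<le> (LINT y|lborel. indicator (ball (0::'a) s) y)"
    proof (rule integral_mono'[OF i])
      show "norm (h y * h (x - y)) \<le> indicator (ball 0 s) y" for y
        using mult_left_mono[OF hb[of "x - y"], of "indicator (ball 0 s) y"] by (simp add: norm_mult hn)
    qed simp
    finally show ?thesis by (simp add: b_def)
  qed
  show "x \<notin> cball 0 (2 * s) \<Longrightarrow> convolution h h x = 0" for x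
  proof (rule convolution_eq_0)
    fix y assume x: "x \<notin> cball 0 (2 * s)" and "h y \<noteq> 0"
    hence "norm y < s" using h0[of y] by auto
    hence "norm (x - y) \<ge> s" using x norm_triangle_ineq2[of x y] by simp
    thus "h (x - y) = 0" by (intro h0) simp
  qed
  show "fourier_transform lborel (convolution h h) l = of_real ((cmod (fourier_transform lborel h l))\<^sup>2)"
  proof -
    have refl: "h (- x) = cnj (h x)" for x by (simp add: h_def cnj_character indicator_def)
    have "fourier_transform lborel h l = (LINT x|lborel. character l (- x) * h (- x))"
      unfolding fourier_transform_character by (rule lborel_integral_reflect[symmetric]) measurable
    also have "\<dots> = (LINT x|lborel. cnj (character l x * h x))"
      by (simp add: refl cnj_character)
    also have "\<dots> = cnj (fourier_transform lborel h l)"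
      by (simp only: Bochner_Integration.integral_cnj fourier_transform_character)
    finally have real: "cnj (fourier_transform lborel h l) = fourier_transform lborel h l" ..
    have "fourier_transform lborel (convolution h h) l = fourier_transform lborel h l * cnj (fourier_transform lborel h l)"
      unfolding fourier_transform_convolution[OF hi hi] real ..
    thus ?thesis by (simp only: complex_norm_square)
  qed
qed

text \<open>
  Dominated convergence in quantitative form: \<open>F\<close> carries all but \<open>c\<close> of the total weight, the factors
  \<open>z\<close> are close to 1 on \<open>F\<close>, and off \<open>F\<close> they are bounded by 1.
\<close>

lemma weighted_infsum_near:
  fixes w :: "'b \<Rightarrow> real" and z :: "'b \<Rightarrow> complex"
  assumes w: "w summable_on A" "\<And>l. l \<in> A \<Longrightarrow> 0 \<le> w l"
    and F: "finite F" "F \<subseteq> A" and c: "c \<ge> 0" "infsum w A \<le> sum w F + c"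
    and z: "\<And>l. norm (z l) \<le> 1" "\<And>l. l \<in> F \<Longrightarrow> norm (z l - 1) \<le> d" and d: "d \<ge> 0"
  shows "(\<lambda>l. norm (of_real (w l) * z l)) summable_on A"
    and "norm (of_real (infsum w A) - (\<Sum>\<^sub>\<infinity>l\<in>A. of_real (w l) * z l)) \<le> d * infsum w A + 2 * c"
proof -
  show s: "(\<lambda>l. norm (of_real (w l) * z l)) summable_on A"
  proof (rule summable_on_comparison_test[OF w(1)])
    show "norm (of_real (w l) * z l) \<le> w l" if "l \<in> A" for l
      using mult_left_mono[OF z(1)[of l] w(2)[OF that]] w(2)[OF that] by (simp add: norm_mult)
  qed simp
  have sw: "(\<lambda>l. complex_of_real (w l)) summable_on A" using w(1) by (rule summable_on_of_real)
  have swz: "(\<lambda>l. of_real (w l) * z l) summable_on A" using s by (rule Infinite_Sum.abs_summable_summable)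
  have eq: "of_real (infsum w A) - (\<Sum>\<^sub>\<infinity>l\<in>A. of_real (w l) * z l) = (\<Sum>\<^sub>\<infinity>l\<in>A. of_real (w l) - of_real (w l) * z l)"
    unfolding infsum_diff[OF sw swz] using has_sum_of_real[OF has_sum_infsum[OF w(1)], where 'a=complex]
    by (simp add: infsumI)
  have fin: "(\<Sum>l\<in>G. norm (of_real (w l) - of_real (w l) * z l)) \<le> d * infsum w A + 2 * c"
    if G: "finite G" "G \<subseteq> A" for G
  proof -
    have n: "norm (of_real (w l) - of_real (w l) * z l) = w l * norm (z l - 1)" if "l \<in> A" for l
    proof -
      have "of_real (w l) - of_real (w l) * z l = of_real (w l) * (1 - z l)" by (simp add: algebra_simps)
      thus ?thesis using w(2)[OF that] by (simp add: norm_mult norm_minus_commute)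
    qed
    have "(\<Sum>l\<in>G. norm (of_real (w l) - of_real (w l) * z l))
       = (\<Sum>l\<in>G \<inter> F. norm (of_real (w l) - of_real (w l) * z l)) + (\<Sum>l\<in>G - F. norm (of_real (w l) - of_real (w l) * z l))"
      using G(1) by (rule sum.Int_Diff)
    also have "\<dots> \<le> (\<Sum>l\<in>G \<inter> F. d * w l) + (\<Sum>l\<in>G - F. 2 * w l)"
    proof (intro add_mono sum_mono)
      fix l assume "l \<in> G \<inter> F"
      hence l: "l \<in> A" "l \<in> F" using F by auto
      show "norm (of_real (w l) - of_real (w l) * z l) \<le> d * w l"
        unfolding n[OF l(1)] using mult_left_mono[OF z(2)[OF l(2)] w(2)[OF l(1)]] by (simp add: mult.commute)
    next
      fix l assume "l \<in> G - F"
      hence l: "l \<in> A" using G by auto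
      have "norm (z l - 1) \<le> 2" using norm_triangle_ineq4[of "z l" 1] z(1)[of l] by simp
      from mult_left_mono[OF this w(2)[OF l]]
      show "norm (of_real (w l) - of_real (w l) * z l) \<le> 2 * w l"
        unfolding n[OF l] by (simp add: mult.commute)
    qed
    also have "\<dots> = d * sum w (G \<inter> F) + 2 * sum w (G - F)" by (simp add: sum_distrib_left)
    also have "\<dots> \<le> d * infsum w A + 2 * c"
    proof -
      have "sum w (G \<inter> F) \<le> infsum w A"
        by (rule finite_sum_le_infsum[OF w(1)]) (use G w(2) in auto)
      moreover have "sum w (F \<union> (G - F)) \<le> infsum w A"
        by (rule finite_sum_le_infsum[OF w(1)]) (use F G w(2) in auto)
      moreover have "sum w (F \<union> (G - F)) = sum w F + sum w (G - F)"
        by (rule sum.union_disjoint) (use F G in auto)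
      ultimately show ?thesis using c(2) d by (intro add_mono mult_left_mono) auto
    qed
    finally show ?thesis .
  qed
  have sd: "(\<lambda>l. norm (of_real (w l) - of_real (w l) * z l)) summable_on A"
    by (rule nonneg_bounded_partial_sums_imp_summable_on[where C="d * infsum w A + 2 * c"])
      (use fin in \<open>auto intro: eventually_finite_subsets_at_top_weakI\<close>)
  show "norm (of_real (infsum w A) - (\<Sum>\<^sub>\<infinity>l\<in>A. of_real (w l) * z l)) \<le> d * infsum w A + 2 * c"
    unfolding eq by (rule order_trans[OF norm_infsum_bound[OF sd] infsum_le_finite_sums[OF sd fin]])
qed

theorem theorem4:
  fixes \<mu> :: "(real ^ 'd) measure" and \<Lambda> :: "(real ^ 'd) set"
  assumes "compact_borel_prob \<mu>"
    and "lebesgue_singular \<mu>"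
    and "countable \<Lambda>"
    and "discrete \<Lambda>"
    and "tight_frame_spectrum \<mu> \<Lambda>"
  shows "zero_spectral_gap (delta_comb \<Lambda>)"
  unfolding zero_spectral_gap_def
proof
  assume "\<exists>a. has_spectral_gap (delta_comb \<Lambda>) a"
  then obtain a where a: "a > 0"
    and gap: "\<And>\<psi>. test_function (ball 0 a - {0}) \<psi> \<Longrightarrow> infsum (fourier_transform lborel \<psi>) \<Lambda> = 0"
    by (auto simp: has_spectral_gap_def distribution_vanishes_on_def distributional_fourier_transform_def delta_comb_def)
  have sets: "sets \<mu> = sets borel" and prob: "prob_space \<mu>"
    using assms(1) by (auto simp: compact_borel_prob_def)
  interpret prob_space \<mu> by fact
  obtain A where A: "A > 0" and frame: "\<And>f. square_integrable \<mu> f \<Longrightarrow>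
        ((\<lambda>l. (cmod (fourier_transform \<mu> f l))\<^sup>2) has_sum A * (LINT x|\<mu>. (cmod (f x))\<^sup>2)) \<Lambda>"
    using assms(5) unfolding tight_frame_spectrum_def by blast
  have small_bessel: "\<exists>r>0. bessel_on_ball \<Lambda> r \<beta>" if "\<beta> > 0" for \<beta>
    by (rule singular_tight_frame_small_bessel[OF sets prob assms(2) A frame that])
  have "\<Lambda> \<noteq> {}"
  proof
    assume "\<Lambda> = {}"
    moreover have "square_integrable \<mu> (\<lambda>_. 1)" by (simp add: square_integrable_def)
    ultimately have "((\<lambda>l. (cmod (fourier_transform \<mu> (\<lambda>_. 1) l))\<^sup>2) has_sum A) {}"
      using frame[of "\<lambda>_. 1"] by (simp add: prob_space)
    hence "A = 0" using infsumI by fastforce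
    thus False using A by simp
  qed
  then obtain l0 where l0: "l0 \<in> \<Lambda>" by blast

  obtain r1 where r1: "r1 > 0" and bessel1: "bessel_on_ball \<Lambda> r1 1"
    using small_bessel[OF zero_less_one] by blast
  define s where "s = min r1 (a / 3)"
  have s: "s > 0" "s \<le> r1" "2 * s \<le> 2 * a / 3" using r1 a by (auto simp: s_def)
  \<comment> \<open>This choice makes \<open>h^\<close> nonzero at \<open>l0\<close>.\<close>
  define h where "h = (\<lambda>x. character l0 (- x) * indicator (ball 0 s) x)"
  define b where "b = measure lborel (ball (0 :: real ^ 'd) s)"
  note h = modulated_ball_autocorrelation[OF h_def b_def]
  have b: "b > 0" using s(1) by (simp add: b_def content_ball_pos)
  define w where "w l = (cmod (fourier_transform lborel h l))\<^sup>2" for l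
  have w0: "w l \<ge> 0" for l by (simp add: w_def)
  have w: "w summable_on \<Lambda>"
  proof (rule nonneg_bounded_partial_sums_imp_summable_on)
    have "sum w F \<le> 1 * (LINT x|lborel. (cmod (h x))\<^sup>2)" if F: "finite F" "F \<subseteq> \<Lambda>" for F
      unfolding w_def by (rule bessel_on_ballD[OF bessel1 h(1) h(3) _ F]) (use s(2) in \<open>auto intro!: h(4)\<close>)
    thus "\<forall>\<^sub>F F in finite_subsets_at_top \<Lambda>. sum w F \<le> 1 * (LINT x|lborel. (cmod (h x))\<^sup>2)"
      by (intro eventually_finite_subsets_at_top_weakI) auto
  qed (rule w0)
  define W where "W = infsum w \<Lambda>"
  have "sum w {l0} \<le> W" unfolding W_def
    by (rule finite_sum_le_infsum[OF w]) (use l0 w0 in auto)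
  moreover have "w l0 = b\<^sup>2" using b by (simp add: w_def h(5))
  ultimately have "b\<^sup>2 \<le> W" by simp
  hence W: "W > 0" using zero_less_power[OF b, of 2] by linarith

  obtain C where C: "C > 0" and moll: "\<And>\<delta>. \<delta> > 0 \<Longrightarrow> \<exists>R::real ^ 'd \<Rightarrow> real. mollifier C \<delta> R"
    using mollifier_exists by blast
  \<comment> \<open>With this choice the bound of \<open>spectral_gap_mollified_sum_small\<close> is \<open>W / 4\<close>.\<close>
  define \<beta> where "\<beta> = W / (2 * (b\<^sup>2 + C))"
  have bC: "b\<^sup>2 + C > 0" using C by (simp add: add_nonneg_pos)
  have \<beta>: "\<beta> > 0" unfolding \<beta>_def by (intro divide_pos_pos mult_pos_pos W bC) simp
  have "W / (2 * K) * K / 2 = W / 4" if "K > 0" for K :: real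
    using that by simp
  from this[OF bC] have \<beta>W: "\<beta> * (b\<^sup>2 + C) / 2 = W / 4"
    unfolding \<beta>_def .
  obtain r where r: "r > 0" and bessel: "bessel_on_ball \<Lambda> r \<beta>"
    using small_bessel[OF \<beta>] by blast
  have "\<exists>F. finite F \<and> F \<subseteq> \<Lambda> \<and> W \<le> sum w F + W / 8"
  proof (rule ccontr)
    assume "\<not> ?thesis"
    hence "\<not> W \<le> sum w F + W / 8" if "finite F" "F \<subseteq> \<Lambda>" for F using that by blast
    hence "sum w F \<le> W - W / 8" if "finite F" "F \<subseteq> \<Lambda>" for F using that by fastforce
    hence "W \<le> W - W / 8" unfolding W_def by (rule infsum_le_finite_sums[OF w])
    thus False using W by simp
  qed
  then obtain F where F: "finite F" "F \<subseteq> \<Lambda>" "W \<le> sum w F + W / 8" by blast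
  define N where "N = (\<Sum>l\<in>F. norm l)"
  have N: "N \<ge> 0" "\<And>l. l \<in> F \<Longrightarrow> norm l \<le> N"
    unfolding N_def using F(1) by (auto intro: sum_nonneg member_le_sum)
  \<comment> \<open>Small enough for the Bessel bound, for the support to stay inside the ball of radius \<open>a\<close>, and for the
    transform of the mollifier to be within \<open>1 / 4\<close> of 1 on \<open>F\<close>.\<close>
  define \<delta> where "\<delta> = min (r / 2) (min (a / 6) (1 / (8 * pi * (N + 1))))"
  have N1: "8 * pi * (N + 1) > 0" using N(1) by (intro mult_pos_pos) auto
  have \<delta>_le: "\<delta> \<le> r / 2" "\<delta> \<le> a / 6" "\<delta> \<le> 1 / (8 * pi * (N + 1))"
    by (simp_all add: \<delta>_def)
  have "\<delta> > 0" using r a N1 by (simp add: \<delta>_def)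
  with \<delta>_le(1,2) s(3) a have \<delta>: "\<delta> > 0" "2 * \<delta> \<le> r" "2 * s + \<delta> < a" by linarith+
  have "\<delta> * (8 * pi * (N + 1)) \<le> 1" using \<delta>_le(3) N1 by (simp only: pos_le_divide_eq)
  moreover have "\<delta> * (8 * pi * (N + 1)) = 4 * (2 * pi * (N + 1) * \<delta>)" by simp
  ultimately have \<delta>N: "2 * pi * (N + 1) * \<delta> \<le> 1 / 4" by linarith
  obtain R :: "real ^ 'd \<Rightarrow> real" where R: "mollifier C \<delta> R"
    using moll[OF \<delta>(1)] by blast
  define z where "z l = fourier_transform lborel (\<lambda>x. of_real (R x)) l" for l
  have z1: "norm (z l) \<le> 1" for l
    unfolding z_def by (rule fourier_transform_mollifier(2)[OF R])
  have z2: "norm (z l - 1) \<le> 1 / 4" if "l \<in> F" for l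
  proof -
    have "norm (z l - 1) \<le> 2 * pi * norm l * \<delta>"
      unfolding z_def by (rule fourier_transform_mollifier(1)[OF R])
    also have "\<dots> \<le> 2 * pi * (N + 1) * \<delta>"
      using N(2)[OF that] \<delta>(1) by (intro mult_right_mono mult_left_mono) auto
    finally show ?thesis using \<delta>N by linarith
  qed
  have near: "(\<lambda>l. norm (of_real (w l) * z l)) summable_on \<Lambda>"
    "norm (of_real W - (\<Sum>\<^sub>\<infinity>l\<in>\<Lambda>. of_real (w l) * z l)) \<le> 1 / 4 * W + 2 * (W / 8)"
    using weighted_infsum_near[OF w w0 F(1,2) _ _ z1 z2, of "W / 8"] W F(3) by (auto simp: W_def)
  have FT: "fourier_transform lborel (convolution h h) l = of_real (w l)" for l
    by (simp only: h(9) w_def)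
  have "norm (\<Sum>\<^sub>\<infinity>l\<in>\<Lambda>. of_real (w l) * z l) \<le> \<beta> * (b\<^sup>2 + C) / 2"
    using spectral_gap_mollified_sum_small[OF bessel gap h(6,7,8) R \<delta> less_imp_le[OF \<beta>]]
      near(1) unfolding FT z_def[symmetric] by blast
  hence "norm (complex_of_real W) \<le> W / 4 + (1 / 4 * W + 2 * (W / 8))"
    using near(2) \<beta>W norm_triangle_sub[of "complex_of_real W" "\<Sum>\<^sub>\<infinity>l\<in>\<Lambda>. of_real (w l) * z l"] by linarith
  thus False using W by simp
qed

end
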